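(* Let $d\ge 2$ and let $\mathcal N$ be a Poisson random set on $\mathbb R^d$ with intensity measure $\mu$ comparable to Lebesgue measure. There are constants $z_1,C_1\in(0,\infty)$ such that for every $z\ge z_1$ and every $n\ge 0$, $$\mathbb P\Big(\max_{\phi\in\mathcal{SA}_n}\mu(\Gamma(\mathcal N,\phi))>nz\Big)\le e^{-C_1nz}.$$
   Context: Comparability of $\mu$ to Lebesgue measure $\lambda_d$: there is $c_\mu>0$ with $\frac1{c_\mu}\lambda_d(A)\le\mu(A)\le c_\mu\lambda_d(A)$ for every Lebesgue-measurable $A\subset\mathbb R^d$. For a locally finite set $\omega\subset\mathbb R^d$ and $v\in\omega$, the Voronoi tile $C_v$ is the set of points of $\mathbb R^d$ at least as close to $v$ as to any other point of $\omega$. The Delaunay graph $\mathcal D(\omega)$ is the graph with vertex set $\omega$ and an edge $\{u,v\}$ whenever $C_u$ and $C_v$ share a $(d-1)$-dimensional face. For a subgraph $\phi$ of $\mathcal D(\omega)$, $$\Gamma(\omega,\phi)=\{x\in\mathbb R^d:\ \phi\not\subset\mathcal D(\omega\cup\{x\})\}.$$ $v(0)$ is the (a.s. unique) $v\in\mathcal N$ with $0\in C_v$. $\mathcal{SA}_n$ is the set of self-avoiding paths on $\mathcal D(\mathcal N)$ starting from $v(0)$ and of size $n$ (i.e. with $n$ vertices); a maximum over an empty set is $0$. *)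

theory Defs
  imports "HOL-Probability.Probability"
begin

definition comparable_to_lebesgue :: "'a::euclidean_space measure \<Rightarrow> bool" where
  "comparable_to_lebesgue \<mu> \<longleftrightarrow>
     sets \<mu> = sets lebesgue \<and>
     (\<exists>c::real. c > 0 \<and>
        (\<forall>A\<in>sets lebesgue.
           ennreal (1 / c) * emeasure lebesgue A \<le> emeasure \<mu> A \<and>
           emeasure \<mu> A \<le> ennreal c * emeasure lebesgue A))"

definition locally_finite :: "'a::euclidean_space set \<Rightarrow> bool" where
  "locally_finite \<omega> \<longleftrightarrow> (\<forall>K. compact K \<longrightarrow> finite (\<omega> \<inter> K))"

text \<open>
  The Poisson probabilities are written out because \<^const>\<open>poisson_pmf\<close> is only specified for a
  strictly positive rate, whereas \<open>A\<close> may be a null set here. Although \<^const>\<open>card\<close> is \<open>0\<close> on infinite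
  sets, the conditions force \<open>N s \<inter> A\<close> to be almost surely finite whenever \<open>\<mu> A < \<infinity>\<close>:
  exhaust \<open>A\<close> by bounded sets and compare expectations.
\<close>

definition poisson_random_set ::
    "'s measure \<Rightarrow> 'a::euclidean_space measure \<Rightarrow> ('s \<Rightarrow> 'a set) \<Rightarrow> bool" where
  "poisson_random_set M \<mu> N \<longleftrightarrow>
     prob_space M \<and>
     (AE s in M. locally_finite (N s)) \<and>
     (\<forall>A\<in>sets borel. emeasure \<mu> A < \<infinity> \<longrightarrow>
        (\<lambda>s. card (N s \<inter> A)) \<in> measurable M (count_space UNIV) \<and>
        (\<forall>k. measure M {s \<in> space M. card (N s \<inter> A) = k}
             = measure \<mu> A ^ k / fact k * exp (- measure \<mu> A))) \<and>
     (\<forall>(I :: nat set) A. finite I \<and> disjoint_family_on A I \<and>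
        (\<forall>i\<in>I. A i \<in> sets borel \<and> emeasure \<mu> (A i) < \<infinity>) \<longrightarrow>
        prob_space.indep_vars M (\<lambda>_. count_space UNIV) (\<lambda>i s. card (N s \<inter> A i)) I)"

definition voronoi_tile :: "'a::euclidean_space set \<Rightarrow> 'a \<Rightarrow> 'a set" where
  "voronoi_tile \<omega> v = {x. \<forall>u\<in>\<omega>. dist x v \<le> dist x u}"

text \<open>A graph is a pair of a vertex set and a set of two-element edges.\<close>

type_synonym 'a graph = "'a set \<times> 'a set set"

definition subgraph :: "'a graph \<Rightarrow> 'a graph \<Rightarrow> bool" where
  "subgraph G H \<longleftrightarrow> fst G \<subseteq> fst H \<and> snd G \<subseteq> snd H"

definition delaunay :: "'a::euclidean_space set \<Rightarrow> 'a graph" where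
  "delaunay \<omega> =
     (\<omega>, {{u, v} | u v. u \<in> \<omega> \<and> v \<in> \<omega> \<and> u \<noteq> v \<and>
            (\<exists>F. F face_of voronoi_tile \<omega> u \<and> F face_of voronoi_tile \<omega> v \<and>
                 aff_dim F = int DIM('a) - 1)})"

definition Gam :: "'a::euclidean_space set \<Rightarrow> 'a graph \<Rightarrow> 'a set" where
  "Gam \<omega> \<phi> = {x. \<not> subgraph \<phi> (delaunay (\<omega> \<union> {x}))}"

text \<open>Only meaningful when exactly one tile contains the origin, which holds almost surely.\<close>

definition origin_nucleus :: "'a::euclidean_space set \<Rightarrow> 'a" where
  "origin_nucleus \<omega> = (THE v. v \<in> \<omega> \<and> 0 \<in> voronoi_tile \<omega> v)"

definition path_graph :: "'a list \<Rightarrow> 'a graph" where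
  "path_graph vs = (set vs, {{vs ! i, vs ! Suc i} | i. Suc i < length vs})"

definition SA :: "'a::euclidean_space set \<Rightarrow> nat \<Rightarrow> 'a graph set" where
  "SA \<omega> n =
     {path_graph vs | vs.
        length vs = n \<and> distinct vs \<and> vs \<noteq> [] \<and> hd vs = origin_nucleus \<omega> \<and>
        subgraph (path_graph vs) (delaunay \<omega>)}"

text \<open>
  The maximum is a supremum in \<^typ>\<open>ennreal\<close>: it is \<open>0\<close> over the empty set, and almost surely
  \<open>SA \<omega> n\<close> is finite, so that it is attained when \<open>SA \<omega> n\<close> is nonempty.
\<close>

definition max_Gam :: "'a::euclidean_space measure \<Rightarrow> 'a set \<Rightarrow> nat \<Rightarrow> ennreal" where
  "max_Gam \<mu> \<omega> n = (SUP \<phi>\<in>SA \<omega> n. emeasure \<mu> (Gam \<omega> \<phi>))"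

text \<open>
  Probabilities of events whose measurability is not established are read as outer probabilities
  (\<^const>\<open>outer_measure_of\<close>), which agree with \<^const>\<open>emeasure\<close> on measurable sets. Note that
  \<^const>\<open>measure\<close> would be \<open>0\<close> on a set outside the sigma-algebra, making an upper bound vacuous.
\<close>

end

theory Submission
  imports Defs
begin

text \<open>
  A point \<open>x\<close> that destroys an edge \<open>{u, v}\<close> of the path lies in a ball around a point of the common
  face of the tiles of \<open>u\<close> and \<open>v\<close> that has \<open>u\<close> on its boundary and no nucleus inside. Such void
  balls also link consecutive vertices of the path, and a void ball around the origin has the first
  vertex on its boundary. Hence the void balls of a path form a connected set containing the origin,
  and the cubic cells of side \<open>a\<close> that meet finitely many of them form a lattice animal \<open>X\<close>.

  Balls of radius below \<open>2 a d\<close> contribute \<open>O(n)\<close> cells. By Vitali's covering lemma, the number of cells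
  meeting the larger balls is at most a constant times the number of cells contained in a disjoint
  subfamily of them, which are free of nuclei. So once \<open>\<mu>(\<Gamma>) > n z\<close> with \<open>z\<close> large, the size of \<open>X\<close>
  is at least of order \<open>n z\<close> and a fixed fraction of its cells is free of nuclei. A union bound over
  the exponentially many animals (encoded by walks that visit all their cells) and their sets of free
  cells concludes, as the Poisson void probabilities beat the entropy when \<open>a\<close> is large.
\<close>

subsection \<open>Cubic cells\<close>

text \<open>Lattice points are kept as vectors of \<open>'a\<close> with integer coordinates, so
  that cells, moves and walks share one type. For \<open>y\<close> outside
  \<open>range (cell_index a)\<close> the set \<open>cell a y\<close> is empty, hence the range
  hypotheses on volumes below.\<close>

definition cell_index :: "real \<Rightarrow> 'a::euclidean_space \<Rightarrow> 'a" where
  "cell_index a x = (\<Sum>b\<in>Basis. of_int \<lfloor>(x \<bullet> b) / a\<rfloor> *\<^sub>R b)"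

definition cell :: "real \<Rightarrow> 'a::euclidean_space \<Rightarrow> 'a set" where
  "cell a y = {x. cell_index a x = y}"

text \<open>The king moves on the lattice, including the zero move: two nearby points may lie in one
  cell, or their indices may differ in every coordinate.\<close>

definition steps :: "'a::euclidean_space set" where
  "steps = {y. \<forall>b\<in>Basis. y \<bullet> b \<in> {-1, 0, 1}}"

lemma cell_index_inner: "b \<in> Basis \<Longrightarrow> cell_index a x \<bullet> b = of_int \<lfloor>(x \<bullet> b) / a\<rfloor>"
  by (simp add: cell_index_def inner_sum_left_Basis)

lemma cell_index_0 [simp]: "cell_index a 0 = 0"
  by (simp add: cell_index_def)

lemma cell_eq:
  fixes y :: "'a::euclidean_space"
  assumes "a > 0" "y \<in> range (cell_index a)"
  shows "cell a y = {x. \<forall>b\<in>Basis. a * (y \<bullet> b) \<le> x \<bullet> b \<and> x \<bullet> b < a * (y \<bullet> b + 1)}"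
proof -
  obtain w where w: "y = cell_index a w" using assms by auto
  have "cell_index a x = y \<longleftrightarrow> (\<forall>b\<in>Basis. a * (y \<bullet> b) \<le> x \<bullet> b \<and> x \<bullet> b < a * (y \<bullet> b + 1))" for x
  proof -
    have "cell_index a x = y \<longleftrightarrow> (\<forall>b\<in>Basis. \<lfloor>(x \<bullet> b) / a\<rfloor> = \<lfloor>(w \<bullet> b) / a\<rfloor>)"
      by (simp add: w euclidean_eq_iff[of "cell_index a x"] cell_index_inner)
    also have "\<dots> \<longleftrightarrow> (\<forall>b\<in>Basis. a * (y \<bullet> b) \<le> x \<bullet> b \<and> x \<bullet> b < a * (y \<bullet> b + 1))"
      using \<open>a > 0\<close> by (intro ball_cong refl)
        (simp add: w cell_index_inner floor_eq_iff pos_le_divide_eq pos_divide_less_eq mult.commute)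
    finally show ?thesis .
  qed
  then show ?thesis by (auto simp: cell_def)
qed

lemma cell_borel:
  assumes "a > 0" "y \<in> range (cell_index a)"
  shows "cell a y \<in> sets borel"
  unfolding cell_eq[OF assms] by measurable

lemma emeasure_cell:
  fixes y :: "'a::euclidean_space"
  assumes "a > 0" "y \<in> range (cell_index a)"
  shows "emeasure lborel (cell a y) = ennreal (a ^ DIM('a))"
proof (rule antisym)
  let ?l = "a *\<^sub>R y" and ?u = "a *\<^sub>R y + (\<Sum>b\<in>Basis. a *\<^sub>R b)"
  have u: "?u \<bullet> b = a * (y \<bullet> b + 1)" if "b \<in> Basis" for b
    using that by (simp add: inner_add_left inner_sum_left_Basis algebra_simps)
  have e: "(\<Prod>b\<in>Basis. (?u - ?l) \<bullet> b) = a ^ DIM('a)"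
    by (simp add: inner_sum_left_Basis)
  have le: "?l \<bullet> b \<le> ?u \<bullet> b" if "b \<in> Basis" for b
    using that \<open>a > 0\<close> by (simp add: u algebra_simps)
  have "cell a y \<subseteq> cbox ?l ?u"
    unfolding cell_eq[OF assms] mem_box subset_iff using u by force
  then have "emeasure lborel (cell a y) \<le> emeasure lborel (cbox ?l ?u)"
    by (intro emeasure_mono) auto
  also have "\<dots> = ennreal (a ^ DIM('a))"
    using le e by (subst emeasure_lborel_cbox) auto
  finally show "emeasure lborel (cell a y) \<le> ennreal (a ^ DIM('a))" .
  have "box ?l ?u \<subseteq> cell a y"
    unfolding cell_eq[OF assms] mem_box subset_iff using u by force
  then have "emeasure lborel (box ?l ?u) \<le> emeasure lborel (cell a y)"
    using cell_borel[OF assms] by (intro emeasure_mono) auto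
  moreover have "emeasure lborel (box ?l ?u) = ennreal (a ^ DIM('a))"
    using le e by (subst emeasure_lborel_box) auto
  ultimately show "ennreal (a ^ DIM('a)) \<le> emeasure lborel (cell a y)" by simp
qed

lemma cells_borel:
  assumes "a > 0" "finite Y" "Y \<subseteq> range (cell_index a)"
  shows "(\<Union>y\<in>Y. cell a y) \<in> sets borel"
  using assms cell_borel by (intro sets.finite_UN) auto

lemma emeasure_cells:
  fixes Y :: "'a::euclidean_space set"
  assumes "a > 0" "finite Y" "Y \<subseteq> range (cell_index a)"
  shows "emeasure lborel (\<Union>y\<in>Y. cell a y) = ennreal (real (card Y) * a ^ DIM('a))"
proof -
  have "emeasure lborel (\<Union>y\<in>Y. cell a y) = (\<Sum>y\<in>Y. emeasure lborel (cell a y))"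
    using assms cell_borel
    by (intro sum_emeasure[symmetric]) (force simp: disjoint_family_on_def cell_def)+
  also have "\<dots> = (\<Sum>y\<in>Y. ennreal (a ^ DIM('a)))"
    using assms by (intro sum.cong emeasure_cell) auto
  also have "\<dots> = ennreal (real (card Y) * a ^ DIM('a))"
    using \<open>a > 0\<close> by (simp add: ennreal_mult' ennreal_of_nat_eq_real_of_nat)
  finally show ?thesis .
qed

lemma floor_diff_less:
  fixes s t :: real
  assumes "\<bar>s - t\<bar> < 1"
  shows "real_of_int \<lfloor>s\<rfloor> - real_of_int \<lfloor>t\<rfloor> \<in> {-1, 0, 1}"
proof -
  have "\<lfloor>s\<rfloor> - \<lfloor>t\<rfloor> = -1 \<or> \<lfloor>s\<rfloor> - \<lfloor>t\<rfloor> = 0 \<or> \<lfloor>s\<rfloor> - \<lfloor>t\<rfloor> = 1"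
    using assms by linarith
  then have "real_of_int (\<lfloor>s\<rfloor> - \<lfloor>t\<rfloor>) \<in> {-1, 0, 1}" by auto
  then show ?thesis by simp
qed

lemma cell_index_near:
  fixes x y :: "'a::euclidean_space"
  assumes "a > 0" "dist x y < a"
  shows "cell_index a y - cell_index a x \<in> steps"
  unfolding steps_def
proof (intro CollectI ballI)
  fix b :: 'a assume b: "b \<in> Basis"
  have "\<bar>(y - x) \<bullet> b\<bar> < a"
    using Basis_le_norm[OF b, of "y - x"] assms by (simp add: dist_norm norm_minus_commute)
  then have "\<bar>y \<bullet> b / a - x \<bullet> b / a\<bar> < 1"
    using \<open>a > 0\<close> by (simp add: diff_divide_distrib[symmetric] inner_diff_left)
  from floor_diff_less[OF this]
  show "(cell_index a y - cell_index a x) \<bullet> b \<in> {-1, 0, 1}"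
    using b by (simp add: inner_diff_left cell_index_inner)
qed

lemma cell_diameter:
  fixes x y :: "'a::euclidean_space"
  assumes "a > 0" "cell_index a x = cell_index a y"
  shows "dist x y \<le> a * DIM('a)"
proof -
  have "\<bar>(x - y) \<bullet> b\<bar> \<le> a" if b: "b \<in> Basis" for b
  proof -
    have "\<lfloor>x \<bullet> b / a\<rfloor> = \<lfloor>y \<bullet> b / a\<rfloor>"
      using assms(2) cell_index_inner[OF b, of a x] cell_index_inner[OF b, of a y] by simp
    then have "\<bar>x \<bullet> b / a - y \<bullet> b / a\<bar> \<le> 1" by linarith
    then show ?thesis
      using \<open>a > 0\<close> by (simp add: diff_divide_distrib[symmetric] inner_diff_left)
  qed
  then have "(\<Sum>b\<in>Basis. \<bar>(x - y) \<bullet> b\<bar>) \<le> (\<Sum>b\<in>(Basis::'a set). a)"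
    by (intro sum_mono) auto
  then show ?thesis
    using norm_le_l1[of "x - y"] by (simp add: dist_norm mult.commute)
qed

lemma finite_steps: "finite (steps :: 'a::euclidean_space set)"
proof (rule finite_subset)
  show "(steps :: 'a set) \<subseteq> (\<lambda>f. \<Sum>b\<in>Basis. f b *\<^sub>R b) ` (Basis \<rightarrow>\<^sub>E {-1, 0, 1})"
  proof
    fix y :: 'a assume "y \<in> steps"
    then have "restrict (\<lambda>b. y \<bullet> b) Basis \<in> Basis \<rightarrow>\<^sub>E {-1, 0, 1}"
      by (simp add: steps_def)
    moreover have "y = (\<Sum>b\<in>Basis. restrict (\<lambda>b. y \<bullet> b) Basis b *\<^sub>R b)"
      by (simp add: euclidean_representation)
    ultimately show "y \<in> (\<lambda>f. \<Sum>b\<in>Basis. f b *\<^sub>R b) ` (Basis \<rightarrow>\<^sub>E {-1, 0, 1})" by blast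
  qed
qed (intro finite_imageI finite_PiE; simp)

section \<open>Counting the cells that meet a ball\<close>

text \<open>Cells are disjoint, and those meeting the ball lie within distance
  \<open>r + a * DIM('a)\<close> of \<open>p\<close>; compare volumes.\<close>

lemma finite_cell_index_cball:
  fixes p :: "'a::euclidean_space" and a r :: real
  assumes "a > 0" "r \<ge> 0"
  shows "finite (cell_index a ` cball p r)"
    and "real (card (cell_index a ` cball p r)) * a ^ DIM('a)
           \<le> unit_ball_vol DIM('a) * (r + a * DIM('a)) ^ DIM('a)"
proof -
  let ?R = "r + a * DIM('a)"
  define B where "B = unit_ball_vol DIM('a) * ?R ^ DIM('a)"
  have R: "?R \<ge> 0" using assms by simp
  \<comment> \<open>The bound is proved for finite subfamilies first, since finiteness of the whole
    family is deduced from it.\<close>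
  have *: "real (card Y) * a ^ DIM('a) \<le> B"
    if Y: "finite Y" "Y \<subseteq> cell_index a ` cball p r" for Y :: "'a set"
  proof -
    have Yr: "Y \<subseteq> range (cell_index a)" using Y by auto
    have "(\<Union>y\<in>Y. cell a y) \<subseteq> cball p ?R"
    proof clarify
      fix x y assume "y \<in> Y" "x \<in> cell a y"
      then obtain w where "dist p w \<le> r" "cell_index a x = cell_index a w"
        using Y by (auto simp: cell_def)
      then show "x \<in> cball p ?R"
        using cell_diameter[OF \<open>a > 0\<close>, of w x] dist_triangle[of p x w] by simp
    qed
    then have "emeasure lborel (\<Union>y\<in>Y. cell a y) \<le> emeasure lborel (cball p ?R)"
      by (intro emeasure_mono) auto
    then have "ennreal (real (card Y) * a ^ DIM('a)) \<le> ennreal B"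
      using emeasure_cells[OF \<open>a > 0\<close> Y(1) Yr] emeasure_cball[OF R, of p] by (simp add: B_def)
    then show ?thesis
      using R by (subst (asm) ennreal_le_iff) (auto simp: B_def)
  qed
  have "finite (cell_index a ` cball p r) \<and> card (cell_index a ` cball p r) \<le> nat \<lfloor>B / a ^ DIM('a)\<rfloor>"
    using *  \<open>a > 0\<close> by (intro finite_if_finite_subsets_card_bdd) (simp add: le_nat_floor pos_le_divide_eq)
  then show fin: "finite (cell_index a ` cball p r)" by simp
  show "real (card (cell_index a ` cball p r)) * a ^ DIM('a)
           \<le> unit_ball_vol DIM('a) * (r + a * DIM('a)) ^ DIM('a)"
    using *[OF fin] by (simp add: B_def)
qed

text \<open>The cells that meet the ball cover it; compare volumes.\<close>

lemma cell_index_ball_lower: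
  fixes p :: "'a::euclidean_space" and a r :: real
  assumes "a > 0" "r \<ge> 0"
  shows "unit_ball_vol DIM('a) * r ^ DIM('a) \<le> real (card (cell_index a ` ball p r)) * a ^ DIM('a)"
proof -
  let ?Y = "cell_index a ` ball p r"
  have fin: "finite ?Y"
    using finite_cell_index_cball(1)[OF assms, of p] by (rule finite_subset[rotated]) auto
  have "ball p r \<subseteq> (\<Union>y\<in>?Y. cell a y)" by (auto simp: cell_def)
  moreover have "(\<Union>y\<in>?Y. cell a y) \<in> sets borel" using assms fin by (intro cells_borel) auto
  ultimately have "emeasure lborel (ball p r) \<le> emeasure lborel (\<Union>y\<in>?Y. cell a y)"
    by (intro emeasure_mono) auto
  also have "\<dots> = ennreal (real (card ?Y) * a ^ DIM('a))"
    using assms fin by (intro emeasure_cells) auto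
  finally show ?thesis
    using assms emeasure_ball[of r p] by (simp add: ennreal_le_iff)
qed

lemma cell_subset_ball:
  fixes p :: "'a::euclidean_space" and a r :: real
  assumes "a > 0" "2 * a * DIM('a) \<le> r" "y \<in> cell_index a ` ball p (r / 2)"
  shows "cell a y \<subseteq> ball p r"
proof
  fix x assume "x \<in> cell a y"
  then obtain w where "dist p w < r / 2" "cell_index a x = cell_index a w"
    using assms by (auto simp: cell_def)
  then show "x \<in> ball p r"
    using cell_diameter[OF \<open>a > 0\<close>, of w x] dist_triangle[of p x w] assms by simp
qed

subsection \<open>Lattice animals and walks\<close>

abbreviation adjacent :: "'a::euclidean_space \<Rightarrow> 'a \<Rightarrow> bool" where
  "adjacent x y \<equiv> y - x \<in> steps"

lemma adjacent_sym: "adjacent x y \<Longrightarrow> adjacent y x"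
  by (auto simp: steps_def inner_diff_left algebra_simps)

definition walks :: "nat \<Rightarrow> 'a::euclidean_space \<Rightarrow> 'a list set" where
  "walks k x = {w. length w = Suc k \<and> hd w = x \<and> successively adjacent w}"

lemma walks_0: "walks 0 x = {[x]}"
  by (auto simp: walks_def length_Suc_conv)

lemma walks_Suc: "walks (Suc k) x = (\<Union>e\<in>steps. (#) x ` walks k (x + e))"
proof (intro subset_antisym subsetI)
  fix w assume "w \<in> walks (Suc k) x"
  then obtain y w' where w: "w = x # y # w'" "length (y # w') = Suc k" "adjacent x y"
      "successively adjacent (y # w')"
    by (auto simp: walks_def length_Suc_conv)
  then have "y # w' \<in> walks k (x + (y - x))" by (simp add: walks_def)
  then show "w \<in> (\<Union>e\<in>steps. (#) x ` walks k (x + e))" using w by blast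
next
  fix w assume "w \<in> (\<Union>e\<in>steps. (#) x ` walks k (x + e))"
  then show "w \<in> walks (Suc k) x"
    by (auto simp: walks_def successively_Cons)
qed

lemma card_walks:
  fixes x :: "'a::euclidean_space"
  shows "finite (walks k x) \<and> card (walks k x) \<le> card (steps :: 'a set) ^ k"
proof (induction k arbitrary: x)
  case 0
  show ?case by (simp add: walks_0)
next
  case (Suc k)
  have "card (walks (Suc k) x) \<le> (\<Sum>e\<in>(steps :: 'a set). card ((#) x ` walks k (x + e)))"
    unfolding walks_Suc by (rule card_UN_le[OF finite_steps])
  also have "\<dots> \<le> (\<Sum>e\<in>(steps :: 'a set). card (steps :: 'a set) ^ k)"
    using Suc by (intro sum_mono order.trans[OF card_image_le]) auto
  finally show ?case
    using Suc finite_steps by (auto simp: walks_Suc)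
qed

text \<open>Hypothesis \<open>link\<close> expresses that \<open>X\<close> is connected. A walk
  gains a new cell \<open>t\<close> next to a visited cell \<open>s\<close> by the detour from
  \<open>s\<close> to \<open>t\<close> and back, at the cost of two steps per cell.\<close>

lemma ex_walk_prefix:
  fixes X :: "'a::euclidean_space set"
  assumes fin: "finite X" and x: "x \<in> X"
    and link: "\<And>S. S \<subset> X \<Longrightarrow> x \<in> S \<Longrightarrow> \<exists>s\<in>S. \<exists>t\<in>X - S. adjacent s t"
    and k: "k < card X"
  shows "\<exists>w\<in>walks (2 * k) x. set w \<subseteq> X \<and> card (set w) = Suc k"
  using k
proof (induction k)
  case 0
  then show ?case using x by (simp add: walks_0)
next
  case (Suc k)
  then obtain w where w: "w \<in> walks (2 * k) x" "set w \<subseteq> X" "card (set w) = Suc k" by auto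
  then have "x \<in> set w" by (cases w) (auto simp: walks_def)
  moreover have "set w \<subset> X" using w Suc.prems by auto
  ultimately obtain s t where st: "s \<in> set w" "t \<in> X" "t \<notin> set w" "adjacent s t"
    using link[of "set w"] by blast
  obtain w1 w2 where w12: "w = w1 @ s # w2" using st(1) by (meson split_list)
  let ?w = "w1 @ s # t # s # w2"
  have "?w \<in> walks (2 * Suc k) x"
    using w(1) st(4) adjacent_sym[OF st(4)]
    by (cases w1) (auto simp: w12 walks_def successively_append_iff successively_Cons hd_append)
  moreover have "set ?w = insert t (set w)" by (auto simp: w12)
  ultimately show ?case using w st by (intro bexI[of _ ?w]) auto
qed

lemma ex_walk:
  fixes X :: "'a::euclidean_space set"
  assumes "finite X" and "x \<in> X"
    and "\<And>S. S \<subset> X \<Longrightarrow> x \<in> S \<Longrightarrow> \<exists>s\<in>S. \<exists>t\<in>X - S. adjacent s t"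
  obtains w where "w \<in> walks (2 * (card X - 1)) x" "set w = X"
proof -
  have "card X > 0" using assms by (auto simp: card_gt_0_iff)
  then obtain w where w: "w \<in> walks (2 * (card X - 1)) x" "set w \<subseteq> X" "card (set w) = card X"
    using ex_walk_prefix[OF assms, where k = "card X - 1"] by auto
  then have "set w = X" using card_subset_eq[OF \<open>finite X\<close>] by blast
  with w(1) show ?thesis by (rule that)
qed

text \<open>Points of \<open>U\<close> at distance below \<open>a\<close> have equal or adjacent
  cells. If no move led out of \<open>S\<close>, lying in a cell of \<open>S\<close> would be a
  locally constant property on \<open>U\<close>, hence constant by connectedness.\<close>

lemma connected_cells_link:
  fixes U :: "'a::euclidean_space set"
  assumes "a > 0" "connected U" "S \<subset> cell_index a ` U" "S \<noteq> {}"
  shows "\<exists>s\<in>S. \<exists>t\<in>cell_index a ` U - S. adjacent s t"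
proof (rule ccontr)
  assume no: "\<not> ?thesis"
  let ?f = "\<lambda>x. cell_index a x \<in> S"
  obtain x y where xy: "x \<in> U" "?f x" "y \<in> U" "\<not> ?f y" using assms(3,4) by blast
  have "\<forall>x\<in>U. \<forall>\<^sub>F y in at x within U. ?f x = ?f y"
  proof
    fix x assume x: "x \<in> U"
    have "?f x = ?f y" if y: "y \<in> U" "dist y x < a" for y
      using no x y cell_index_near[OF \<open>a > 0\<close>, of x y] cell_index_near[OF \<open>a > 0\<close>, of y x]
      by (force simp: dist_commute)
    then show "\<forall>\<^sub>F y in at x within U. ?f x = ?f y"
      using \<open>a > 0\<close> unfolding eventually_at by blast
  qed
  from connected_local_const[OF \<open>connected U\<close> xy(1,3) this] xy show False by simp
qed

subsection \<open>Cells meeting void balls\<close>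

text \<open>The constant \<open>12 ^ DIM('a)\<close> is the volume ratio between a ball of radius \<open>6 r\<close>, which contains
  all cells meeting the ball of radius \<open>5 r\<close>, and one of radius \<open>r / 2\<close>, all of whose cells lie
  within radius \<open>r\<close>.\<close>

lemma card_cells_5_le:
  fixes p :: "'a::euclidean_space" and a r :: real
  assumes "a > 0" "2 * a * DIM('a) \<le> r"
  shows "card (cell_index a ` cball p (5 * r)) \<le> 12 ^ DIM('a) * card (cell_index a ` ball p (r / 2))"
proof -
  have r: "r \<ge> 0" using assms by (smt (verit) mult_nonneg_nonneg of_nat_0_le_iff)
  have "real (card (cell_index a ` cball p (5 * r))) * a ^ DIM('a)
      \<le> unit_ball_vol DIM('a) * (5 * r + a * DIM('a)) ^ DIM('a)"
    using finite_cell_index_cball(2)[of a "5 * r" p] assms r by simp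
  also have "\<dots> \<le> unit_ball_vol DIM('a) * (12 * (r / 2)) ^ DIM('a)"
    using assms r by (intro mult_left_mono power_mono) auto
  also have "\<dots> = 12 ^ DIM('a) * (unit_ball_vol DIM('a) * (r / 2) ^ DIM('a))"
    by (simp only: power_mult_distrib mult_ac)
  also have "\<dots> \<le> 12 ^ DIM('a) * (real (card (cell_index a ` ball p (r / 2))) * a ^ DIM('a))"
    using cell_index_ball_lower[of a "r / 2" p] assms r by (intro mult_left_mono) auto
  finally have "real (card (cell_index a ` cball p (5 * r))) * a ^ DIM('a)
      \<le> real (12 ^ DIM('a) * card (cell_index a ` ball p (r / 2))) * a ^ DIM('a)"
    by (simp add: mult_ac)
  then have "real (card (cell_index a ` cball p (5 * r)))
      \<le> real (12 ^ DIM('a) * card (cell_index a ` ball p (r / 2)))"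
    using \<open>a > 0\<close> by (subst (asm) mult_le_cancel_right_pos) auto
  then show ?thesis by (simp only: of_nat_le_iff)
qed

text \<open>Vitali selects disjoint balls, indexed by \<open>C\<close>, whose fivefold enlargements
  cover the union. The cells meeting their half-radius balls are at least a fraction
  \<open>1 / 12 ^ DIM('a)\<close> of \<open>X\<close>, and each lies inside a void ball.\<close>

lemma cells_of_large_balls:
  fixes p :: "'i \<Rightarrow> 'a::euclidean_space" and r :: "'i \<Rightarrow> real" and a :: real
  assumes "a > 0" "finite J"
    and large: "\<And>j. j \<in> J \<Longrightarrow> 2 * a * DIM('a) \<le> r j"
    and void: "\<And>j. j \<in> J \<Longrightarrow> ball (p j) (r j) \<inter> \<omega> = {}"
  defines "X \<equiv> cell_index a ` (\<Union>j\<in>J. cball (p j) (r j))"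
  shows "card X \<le> 12 ^ DIM('a) * card {y \<in> X. cell a y \<inter> \<omega> = {}}"
proof -
  let ?in = "\<lambda>j. cell_index a ` ball (p j) (r j / 2)" and ?E = "{y \<in> X. cell a y \<inter> \<omega> = {}}"
  have pos: "r j > 0" if "j \<in> J" for j
    using large[OF that] \<open>a > 0\<close> by (smt (verit) DIM_positive mult_pos_pos of_nat_0_less_iff)
  have fin: "finite (cell_index a ` cball (p j) s)" for j s
  proof (cases "s \<ge> 0")
    case True
    then show ?thesis by (rule finite_cell_index_cball(1)[OF \<open>a > 0\<close>])
  qed simp
  have finX: "finite X" using \<open>finite J\<close> fin by (simp add: X_def image_UN)
  have fin_in: "finite (?in j)" for j
    by (rule finite_subset[OF _ fin[of j "r j / 2"]]) auto
  obtain C where C: "C \<subseteq> J" "pairwise (\<lambda>i j. disjnt (cball (p i) (r i)) (cball (p j) (r j))) C"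
      "(\<Union>j\<in>J. cball (p j) (r j)) \<subseteq> (\<Union>j\<in>C. cball (p j) (5 * r j))"
  proof (rule Vitali_covering_lemma_cballs[where a = p and r = r and K = J, OF order.refl])
    show "0 < r j \<and> r j \<le> Max (r ` J)" if "j \<in> J" for j
      using that pos \<open>finite J\<close> by simp
  qed auto
  have finC: "finite C" using C(1) \<open>finite J\<close> by (rule finite_subset)
  have "card X \<le> card (\<Union>j\<in>C. cell_index a ` cball (p j) (5 * r j))"
    using finC fin unfolding X_def image_UN[symmetric]
    by (intro card_mono image_mono C(3)) (simp add: image_UN)
  also have "\<dots> \<le> (\<Sum>j\<in>C. card (cell_index a ` cball (p j) (5 * r j)))"
    by (rule card_UN_le[OF finC])
  also have "\<dots> \<le> (\<Sum>j\<in>C. 12 ^ DIM('a) * card (?in j))"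
    using C(1) large by (intro sum_mono card_cells_5_le[OF \<open>a > 0\<close>]) auto
  also have "\<dots> = 12 ^ DIM('a) * (\<Sum>j\<in>C. card (?in j))"
    by (simp add: sum_distrib_left)
  also have "(\<Sum>j\<in>C. card (?in j)) = card (\<Union>j\<in>C. ?in j)"
  proof (rule card_UN_disjoint[symmetric])
    show "\<forall>i\<in>C. \<forall>j\<in>C. i \<noteq> j \<longrightarrow> ?in i \<inter> ?in j = {}"
    proof (intro ballI impI)
      \<comment> \<open>A cell common to \<open>?in i\<close> and \<open>?in j\<close> would be
        nonempty and contained in two disjoint balls.\<close>
      fix i j assume ij: "i \<in> C" "j \<in> C" "i \<noteq> j"
      have "ball (p i) (r i) \<inter> ball (p j) (r j) = {}"
        using pairwiseD[OF C(2) ij] ball_subset_cball unfolding disjnt_def by blast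
      moreover have "y \<in> cell_index a ` ball (p j) (r j / 2) \<Longrightarrow> cell a y \<subseteq> ball (p j) (r j)"
        if "j \<in> C" for y j
        using cell_subset_ball[OF \<open>a > 0\<close> large] C(1) that by blast
      moreover have "y \<in> ?in i \<Longrightarrow> cell a y \<noteq> {}" for y by (auto simp: cell_def)
      ultimately show "?in i \<inter> ?in j = {}" using ij(1,2) by blast
    qed
  qed (use finC fin_in in auto)
  also have "card (\<Union>j\<in>C. ?in j) \<le> card ?E"
  proof (rule card_mono)
    show "(\<Union>j\<in>C. ?in j) \<subseteq> ?E"
    proof clarsimp
      fix j x assume jx: "j \<in> C" "dist (p j) x * 2 < r j"
      then have j: "j \<in> J" using C(1) by auto
      have "cell a (cell_index a x) \<subseteq> ball (p j) (r j)"
        using jx cell_subset_ball[OF \<open>a > 0\<close> large[OF j], where y = "cell_index a x" and p = "p j"] by auto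
      moreover have "x \<in> cball (p j) (r j)"
        using jx zero_le_dist[of "p j" x] unfolding mem_cball by linarith
      then have "cell_index a x \<in> X" unfolding X_def using j by (intro imageI) auto
      ultimately show "cell_index a x \<in> X \<and> cell a (cell_index a x) \<inter> \<omega> = {}"
        using void[OF j] by auto
    qed
  qed (use finX in auto)
  finally show ?thesis by simp
qed

text \<open>Bounds the number of cells that meet a ball of radius \<open>4 * a * DIM('a)\<close>:
  enlarging by a cell diameter gives the factor 5, and the powers of \<open>a\<close>
  cancel.\<close>

definition cells_per_vertex :: "'a::euclidean_space itself \<Rightarrow> real" where
  "cells_per_vertex _ = unit_ball_vol DIM('a) * (5 * real DIM('a)) ^ DIM('a)"

text \<open>The balls are split by radius at \<open>2 * a * DIM('a)\<close>: the small ones stay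
  close to \<open>V\<close>, and the large ones are handled by the covering argument.\<close>

lemma cells_of_balls:
  fixes p :: "'i \<Rightarrow> 'a::euclidean_space" and r :: "'i \<Rightarrow> real" and a :: real
  assumes "a > 0" "finite J" "finite V"
    and void: "\<And>j. j \<in> J \<Longrightarrow> ball (p j) (r j) \<inter> \<omega> = {}"
    and touch: "\<And>j. j \<in> J \<Longrightarrow> \<exists>u\<in>V. dist (p j) u = r j"
  defines "X \<equiv> cell_index a ` (\<Union>j\<in>J. cball (p j) (r j))"
  shows "finite X"
    and "real (card X) \<le> cells_per_vertex TYPE('a) * card V + 12 ^ DIM('a) * card {y \<in> X. cell a y \<inter> \<omega> = {}}"
proof -
  let ?E = "{y \<in> X. cell a y \<inter> \<omega> = {}}"
  \<comment> \<open>A ball of radius below \<open>2 * a * DIM('a)\<close> that touches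
    \<open>u\<close> lies within twice that distance of \<open>u\<close>.\<close>
  let ?R = "2 * (2 * a * DIM('a))"
  have R: "?R \<ge> 0" using \<open>a > 0\<close> by simp
  define J1 where "J1 = {j \<in> J. 2 * a * DIM('a) \<le> r j}"
  define X1 where "X1 = cell_index a ` (\<Union>j\<in>J1. cball (p j) (r j))"
  define X0 where "X0 = (\<Union>u\<in>V. cell_index a ` cball u ?R)"
  have fin_r: "finite (cell_index a ` cball (p j) (r j))" if "j \<in> J" for j
    using touch[OF that] finite_cell_index_cball(1)[OF \<open>a > 0\<close>, of "r j" "p j"]
    by (metis zero_le_dist)
  show finX: "finite X" using \<open>finite J\<close> fin_r by (simp add: X_def image_UN)
  have X1X: "X1 \<subseteq> X" by (auto simp: X1_def X_def J1_def)
  have fin0: "finite X0" unfolding X0_def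
    by (rule finite_UN_I[OF \<open>finite V\<close>]) (rule finite_cell_index_cball(1)[OF \<open>a > 0\<close> R])
  have "X \<subseteq> X0 \<union> X1"
  proof
    fix y assume "y \<in> X"
    then obtain j x where j: "j \<in> J" "dist (p j) x \<le> r j" "y = cell_index a x"
      by (auto simp: X_def)
    show "y \<in> X0 \<union> X1"
    proof (cases "j \<in> J1")
      case True
      then have "x \<in> (\<Union>j\<in>J1. cball (p j) (r j))" using j(2) by auto
      then show ?thesis using j(3) by (simp add: X1_def)
    next
      case False
      obtain u where u: "u \<in> V" "dist (p j) u = r j" using touch[OF j(1)] by auto
      have "dist u x \<le> ?R"
        using False j u dist_triangle[of u x "p j"] by (auto simp: J1_def dist_commute)
      then have "x \<in> cball u ?R" by simp
      then show ?thesis using j(3) u(1) unfolding X0_def by blast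
    qed
  qed
  then have "card X \<le> card (X0 \<union> X1)"
    using fin0 finite_subset[OF X1X finX] by (intro card_mono) auto
  also have "\<dots> \<le> card X0 + card X1" by (rule card_Un_le)
  finally have "real (card X) \<le> card X0 + card X1" by simp
  moreover have "real (card X0) \<le> cells_per_vertex TYPE('a) * card V"
  proof -
    have "real (card (cell_index a ` cball u ?R)) \<le> cells_per_vertex TYPE('a)" for u :: 'a
    proof -
      have "real (card (cell_index a ` cball u ?R)) * a ^ DIM('a)
          \<le> unit_ball_vol DIM('a) * (a * (5 * real DIM('a))) ^ DIM('a)"
        using finite_cell_index_cball(2)[OF \<open>a > 0\<close> R, of u] by (simp add: algebra_simps)
      also have "\<dots> = cells_per_vertex TYPE('a) * a ^ DIM('a)"
        by (simp only: cells_per_vertex_def power_mult_distrib mult_ac)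
      finally show ?thesis
        using \<open>a > 0\<close> by (subst (asm) mult_le_cancel_right_pos) auto
    qed
    then have "(\<Sum>u\<in>V. real (card (cell_index a ` cball u ?R))) \<le> (\<Sum>u\<in>V. cells_per_vertex TYPE('a))"
      by (intro sum_mono)
    moreover have "real (card X0) \<le> (\<Sum>u\<in>V. real (card (cell_index a ` cball u ?R)))"
      using card_UN_le[OF \<open>finite V\<close>, of "\<lambda>u. cell_index a ` cball u ?R"]
      unfolding X0_def of_nat_sum[symmetric] of_nat_le_iff .
    ultimately show ?thesis by (simp add: mult.commute)
  qed
  moreover have "real (card X1) \<le> 12 ^ DIM('a) * card ?E"
  proof -
    have "card X1 \<le> 12 ^ DIM('a) * card {y \<in> X1. cell a y \<inter> \<omega> = {}}"
      unfolding X1_def using assms by (intro cells_of_large_balls) (auto simp: J1_def)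
    also have "\<dots> \<le> 12 ^ DIM('a) * card ?E"
      using X1X finX by (intro mult_left_mono card_mono) auto
    finally show ?thesis by (metis of_nat_le_iff of_nat_mult of_nat_numeral of_nat_power)
  qed
  ultimately show "real (card X) \<le> cells_per_vertex TYPE('a) * card V + 12 ^ DIM('a) * card ?E" by linarith
qed

subsection \<open>Void balls along a Delaunay path\<close>

lemma delaunay_edge_iff:
  fixes u v :: "'a::euclidean_space"
  shows "{u, v} \<in> snd (delaunay \<omega>) \<longleftrightarrow> u \<in> \<omega> \<and> v \<in> \<omega> \<and> u \<noteq> v \<and>
    (\<exists>F. F face_of voronoi_tile \<omega> u \<and> F face_of voronoi_tile \<omega> v \<and> aff_dim F = int DIM('a) - 1)"
  unfolding delaunay_def by (auto simp: doubleton_eq_iff)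

lemma voronoi_void_ball:
  assumes "p \<in> voronoi_tile \<omega> u"
  shows "ball p (dist p u) \<inter> \<omega> = {}"
  using assms by (force simp: voronoi_tile_def)

lemma voronoi_dist_eq:
  assumes "p \<in> voronoi_tile \<omega> u" "p \<in> voronoi_tile \<omega> v" "u \<in> \<omega>" "v \<in> \<omega>"
  shows "dist p u = dist p v"
  using assms by (intro antisym) (auto simp: voronoi_tile_def)

lemma delaunay_edge_void_ball:
  fixes u v :: "'a::euclidean_space"
  assumes "{u, v} \<in> snd (delaunay \<omega>)"
  obtains p where "ball p (dist p u) \<inter> \<omega> = {}" "dist p v = dist p u"
proof -
  obtain F where uv: "u \<in> \<omega>" "v \<in> \<omega>" and F: "F face_of voronoi_tile \<omega> u" "F face_of voronoi_tile \<omega> v"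
      "aff_dim F = int DIM('a) - 1"
    using assms unfolding delaunay_edge_iff by blast
  \<comment> \<open>Only the empty set has dimension -1, so the common face contains a point, and
    any such point serves as centre.\<close>
  have "aff_dim F \<noteq> -1" using F(3) DIM_positive[where 'a='a] by linarith
  then obtain p where "p \<in> F" by (metis aff_dim_empty_eq ex_in_conv aff_dim_empty)
  then have p: "p \<in> voronoi_tile \<omega> u" "p \<in> voronoi_tile \<omega> v"
    using F(1,2) face_of_imp_subset by blast+
  show ?thesis
    using that[OF voronoi_void_ball[OF p(1)]] voronoi_dist_eq[OF p uv] by simp
qed

text \<open>Adding \<open>x\<close> keeps the common face \<open>F\<close> of two tiles unless \<open>x\<close> is closer to some \<open>p \<in> F\<close> than
  their nuclei are.\<close>

lemma delaunay_edge_destroyed: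
  fixes u v :: "'a::euclidean_space"
  assumes "{u, v} \<in> snd (delaunay \<omega>)" "{u, v} \<notin> snd (delaunay (\<omega> \<union> {x}))"
  obtains p where "ball p (dist p u) \<inter> \<omega> = {}" "x \<in> ball p (dist p u)"
proof -
  obtain F where uv: "u \<in> \<omega>" "v \<in> \<omega>" "u \<noteq> v"
    and F: "F face_of voronoi_tile \<omega> u" "F face_of voronoi_tile \<omega> v" "aff_dim F = int DIM('a) - 1"
    using assms(1) unfolding delaunay_edge_iff by blast
  have sub: "F \<subseteq> voronoi_tile \<omega> u" "F \<subseteq> voronoi_tile \<omega> v"
    using F face_of_imp_subset by blast+
  have mono: "voronoi_tile (\<omega> \<union> {x}) w \<subseteq> voronoi_tile \<omega> w" for w
    by (auto simp: voronoi_tile_def)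
  have "\<exists>p\<in>F. dist p x < dist p u"
  proof (rule ccontr)
    assume "\<not> ?thesis"
    then have far: "dist p u \<le> dist p x" if "p \<in> F" for p using that by force
    have "dist p u = dist p v" if "p \<in> F" for p
      using voronoi_dist_eq[of p \<omega> u v] sub uv that by blast
    then have "F \<subseteq> voronoi_tile (\<omega> \<union> {x}) u" "F \<subseteq> voronoi_tile (\<omega> \<union> {x}) v"
      using sub far by (fastforce simp: voronoi_tile_def)+
    \<comment> \<open>Adding \<open>x\<close> shrinks every tile, and a face of a set is a face of
      each smaller set that still contains it.\<close>
    then have "F face_of voronoi_tile (\<omega> \<union> {x}) u" "F face_of voronoi_tile (\<omega> \<union> {x}) v"
      using face_of_subset[OF F(1) _ mono] face_of_subset[OF F(2) _ mono] by blast+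
    then show False using assms(2) uv F(3) unfolding delaunay_edge_iff by blast
  qed
  then obtain p where p: "p \<in> F" "dist p x < dist p u" by blast
  then show ?thesis using that[of p] voronoi_void_ball[of p \<omega> u] sub by auto
qed

text \<open>Balls are stored as pairs of centre and radius, since the covering lemma needs the
  radii.\<close>

definition void_balls :: "'a::euclidean_space set \<Rightarrow> 'a set \<Rightarrow> ('a \<times> real) set" where
  "void_balls \<omega> V = {(p, r). ball p r \<inter> \<omega> = {} \<and> (\<exists>u\<in>V. dist p u = r)}"

lemma Gam_path_void_ball:
  assumes "subgraph (path_graph vs) (delaunay \<omega>)" "x \<in> Gam \<omega> (path_graph vs)"
  shows "\<exists>(p, r) \<in> void_balls \<omega> (set vs). x \<in> ball p r"
proof -
  \<comment> \<open>Adding a point never removes a vertex, so only the loss of an edge can put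
    \<open>x\<close> into \<open>Gam\<close>.\<close>
  have "fst (path_graph vs) \<subseteq> fst (delaunay (\<omega> \<union> {x}))"
    using assms(1) by (auto simp: subgraph_def delaunay_def)
  then have "\<not> snd (path_graph vs) \<subseteq> snd (delaunay (\<omega> \<union> {x}))"
    using assms(2) by (auto simp: Gam_def subgraph_def)
  then obtain i where i: "Suc i < length vs" "{vs ! i, vs ! Suc i} \<notin> snd (delaunay (\<omega> \<union> {x}))"
    by (auto simp: path_graph_def)
  then have "{vs ! i, vs ! Suc i} \<in> snd (delaunay \<omega>)"
    using assms(1) by (auto simp: subgraph_def path_graph_def)
  then obtain p where "ball p (dist p (vs ! i)) \<inter> \<omega> = {}" "x \<in> ball p (dist p (vs ! i))"
    using i(2) by (rule delaunay_edge_destroyed)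
  then show ?thesis
    using i(1) by (intro bexI[of _ "(p, dist p (vs ! i))"]) (auto simp: void_balls_def)
qed

text \<open>The chain starts with the ball around the origin through the first vertex; each edge
  then adds a ball with both endpoints on its boundary. Closed balls are taken so that consecutive
  ones meet in the shared vertex.\<close>

lemma path_connected_void_balls:
  assumes path: "subgraph (path_graph vs) (delaunay \<omega>)"
    and origin: "0 \<in> voronoi_tile \<omega> (hd vs)"
    and "k < length vs"
  shows "\<exists>J. finite J \<and> J \<subseteq> void_balls \<omega> (set vs) \<and> connected (\<Union>(p, r)\<in>J. cball p r) \<and>
    0 \<in> (\<Union>(p, r)\<in>J. cball p r) \<and> (\<forall>i\<le>k. vs ! i \<in> (\<Union>(p, r)\<in>J. cball p r))"
  using \<open>k < length vs\<close>
proof (induction k)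
  case 0
  then have hd: "hd vs = vs ! 0" "vs ! 0 \<in> set vs" by (auto simp: hd_conv_nth)
  then show ?case
    using voronoi_void_ball[OF origin]
    by (intro exI[of _ "{(0, dist 0 (vs ! 0))}"]) (auto simp: void_balls_def simp del: dist_0_norm)
next
  case (Suc k)
  then obtain J where J: "finite J" "J \<subseteq> void_balls \<omega> (set vs)" "connected (\<Union>(p, r)\<in>J. cball p r)"
    "0 \<in> (\<Union>(p, r)\<in>J. cball p r)" "\<forall>i\<le>k. vs ! i \<in> (\<Union>(p, r)\<in>J. cball p r)" by auto
  have "{vs ! k, vs ! Suc k} \<in> snd (delaunay \<omega>)"
    using path Suc.prems by (auto simp: subgraph_def path_graph_def)
  then obtain p where p: "ball p (dist p (vs ! k)) \<inter> \<omega> = {}" "dist p (vs ! Suc k) = dist p (vs ! k)"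
    by (rule delaunay_edge_void_ball)
  let ?b = "(p, dist p (vs ! k))" and ?U = "\<Union>(p, r)\<in>J. cball p r"
  have "connected (cball p (dist p (vs ! k)) \<union> ?U)"
    using J(3,5) by (intro connected_Un) auto
  moreover have "?b \<in> void_balls \<omega> (set vs)"
    using p Suc.prems by (auto simp: void_balls_def)
  moreover have "\<forall>i\<le>Suc k. vs ! i \<in> cball p (dist p (vs ! k)) \<union> ?U"
    using J(5) p(2) by (auto simp: le_Suc_eq)
  ultimately show ?case
    using J by (intro exI[of _ "insert ?b J"]) auto
qed

text \<open>This attaches to the chain \<open>J\<close> the balls that contain destroying points:
  each touches a vertex of the path, which \<open>J\<close> already covers.\<close>

lemma connected_Union_balls:
  assumes "connected (\<Union>(p, r)\<in>J. cball p r)"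
    and meet: "\<And>p r. (p, r) \<in> K \<Longrightarrow> \<exists>u\<in>cball p r. u \<in> (\<Union>(p, r)\<in>J. cball p r)"
    and z: "z \<in> (\<Union>(p, r)\<in>J. cball p r)"
  shows "connected (\<Union>(p, r)\<in>J \<union> K. cball (p :: 'a::euclidean_space) r)"
proof -
  let ?U = "\<Union>(p, r)\<in>J. cball p r"
  have "connected (\<Union>(insert ?U ((\<lambda>(p, r). ?U \<union> cball p r) ` K)))"
  proof (rule connected_Union)
    fix S assume "S \<in> insert ?U ((\<lambda>(p, r). ?U \<union> cball p r) ` K)"
    then consider "S = ?U" | p r where "(p, r) \<in> K" "S = ?U \<union> cball p r" by blast
    then show "connected S"
    proof cases
      case 1
      then show ?thesis using assms(1) by simp
    next
      case 2
      then have "?U \<inter> cball p r \<noteq> {}" using meet by blast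
      then show ?thesis unfolding 2(2) by (intro connected_Un assms(1)) auto
    qed
  qed (use z in auto)
  also have "\<Union>(insert ?U ((\<lambda>(p, r). ?U \<union> cball p r) ` K)) = (\<Union>(p, r)\<in>J \<union> K. cball p r)"
    by auto
  finally show ?thesis .
qed

section \<open>From a large volume to a large animal\<close>

text \<open>If \<open>G\<close> meets finitely many cells, these cover it and each has measure at
  most \<open>c * a ^ DIM('a)\<close>. Otherwise any number of them is available.\<close>

lemma many_cells:
  fixes \<mu> :: "'a::euclidean_space measure"
  assumes "a > 0" "c > 0" "t \<ge> 0" and sets: "sets \<mu> = sets lebesgue"
    and ub: "\<forall>A\<in>sets lebesgue. emeasure \<mu> A \<le> ennreal c * emeasure lebesgue A"
    and big: "ennreal t < emeasure \<mu> G"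
  obtains Y where "finite Y" "Y \<subseteq> cell_index a ` G" "t < c * a ^ DIM('a) * card Y"
proof (cases "finite (cell_index a ` G)")
  case True
  let ?Y = "cell_index a ` G" and ?A = "\<Union>y\<in>cell_index a ` G. cell a y"
  have A: "?A \<in> sets borel" using True \<open>a > 0\<close> by (intro cells_borel) auto
  then have Al: "?A \<in> sets lebesgue" by (simp add: sets_completionI_sets)
  \<comment> \<open>Should \<open>G\<close> be nonmeasurable, the left side is 0 by
    convention.\<close>
  have "emeasure \<mu> G \<le> emeasure \<mu> ?A"
    using Al sets by (intro emeasure_mono) (auto simp: cell_def)
  also have "\<dots> \<le> ennreal c * emeasure lebesgue ?A" by (rule bspec[OF ub Al])
  also have "\<dots> = ennreal c * ennreal (card ?Y * a ^ DIM('a))"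
  proof -
    have "emeasure lebesgue ?A = emeasure lborel ?A" using A by simp
    also have "\<dots> = ennreal (card ?Y * a ^ DIM('a))"
      by (rule emeasure_cells[OF \<open>a > 0\<close> True]) auto
    finally show ?thesis by simp
  qed
  also have "\<dots> = ennreal (c * a ^ DIM('a) * card ?Y)"
    using \<open>c > 0\<close> by (subst ennreal_mult'[symmetric]) (auto simp: mult_ac)
  finally have "ennreal t < ennreal (c * a ^ DIM('a) * card ?Y)" using big by (rule less_le_trans[rotated])
  then show ?thesis using that[of ?Y] True \<open>t \<ge> 0\<close> by (simp add: ennreal_less_iff)
next
  case False
  obtain k :: nat where "t / (c * a ^ DIM('a)) < k" using reals_Archimedean2 by blast
  moreover obtain Y where "finite Y" "card Y = k" "Y \<subseteq> cell_index a ` G"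
    using infinite_arbitrarily_large[OF False] by blast
  ultimately show ?thesis
    using that[of Y] assms(1,2) by (simp add: pos_divide_less_eq mult.commute)
qed

lemma path_animal:
  fixes \<mu> :: "'a::euclidean_space measure"
  assumes "a > 0" "c > 0" "t \<ge> 0" and sets: "sets \<mu> = sets lebesgue"
    and ub: "\<forall>A\<in>sets lebesgue. emeasure \<mu> A \<le> ennreal c * emeasure lebesgue A"
    and path: "subgraph (path_graph vs) (delaunay \<omega>)" "vs \<noteq> []"
    and origin: "0 \<in> voronoi_tile \<omega> (hd vs)"
    and big: "ennreal t < emeasure \<mu> (Gam \<omega> (path_graph vs))"
  obtains X w where "finite X" "X \<subseteq> range (cell_index a)" "t < c * a ^ DIM('a) * card X"
    "w \<in> walks (2 * (card X - 1)) 0" "set w = X"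
    "real (card X) \<le> cells_per_vertex TYPE('a) * length vs + 12 ^ DIM('a) * card {y \<in> X. cell a y \<inter> \<omega> = {}}"
proof -
  obtain J where J: "finite J" "J \<subseteq> void_balls \<omega> (set vs)" "connected (\<Union>(p, r)\<in>J. cball p r)"
    "0 \<in> (\<Union>(p, r)\<in>J. cball p r)" "\<forall>i\<le>length vs - 1. vs ! i \<in> (\<Union>(p, r)\<in>J. cball p r)"
    using path_connected_void_balls[OF path(1) origin, of "length vs - 1"] path(2) by auto
  have vsJ: "u \<in> (\<Union>(p, r)\<in>J. cball p r)" if u: "u \<in> set vs" for u
  proof -
    obtain i where "i < length vs" "u = vs ! i" using u by (metis in_set_conv_nth)
    then show ?thesis using J(5) by auto
  qed
  obtain Y where Y: "finite Y" "Y \<subseteq> cell_index a ` Gam \<omega> (path_graph vs)" "t < c * a ^ DIM('a) * card Y"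
    using many_cells[OF assms(1-3) sets ub big] by blast
  \<comment> \<open>One void ball for each cell of the finite set \<open>Y\<close> accounts for the
    volume while keeping the family of balls finite.\<close>
  have "\<forall>y\<in>Y. \<exists>b\<in>void_balls \<omega> (set vs). y \<in> cell_index a ` cball (fst b) (snd b)"
  proof
    fix y assume "y \<in> Y"
    then obtain x where x: "x \<in> Gam \<omega> (path_graph vs)" "y = cell_index a x" using Y(2) by auto
    obtain p r where pr: "(p, r) \<in> void_balls \<omega> (set vs)" "x \<in> ball p r"
      using Gam_path_void_ball[OF path(1) x(1)] by blast
    then have "x \<in> cball p r" using ball_subset_cball by blast
    then show "\<exists>b\<in>void_balls \<omega> (set vs). y \<in> cell_index a ` cball (fst b) (snd b)"
      using pr(1) x(2) by (intro bexI[of _ "(p, r)"]) auto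
  qed
  then obtain f where f: "\<And>y. y \<in> Y \<Longrightarrow> f y \<in> void_balls \<omega> (set vs)"
      "\<And>y. y \<in> Y \<Longrightarrow> y \<in> cell_index a ` cball (fst (f y)) (snd (f y))" by metis
  define K where "K = J \<union> f ` Y"
  define U where "U = (\<Union>(p, r)\<in>K. cball p r)"
  define X where "X = cell_index a ` U"
  have X_alt: "X = cell_index a ` (\<Union>b\<in>K. cball (fst b) (snd b))"
    by (simp add: X_def U_def case_prod_beta')
  have K: "finite K" "K \<subseteq> void_balls \<omega> (set vs)" using J Y f(1) by (auto simp: K_def)
  have conn: "connected U"
    unfolding U_def K_def
  proof (rule connected_Union_balls[OF J(3) _ J(4)])
    fix p r assume "(p, r) \<in> f ` Y"
    then have "(p, r) \<in> void_balls \<omega> (set vs)" using f(1) by auto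
    then obtain u where "u \<in> set vs" "dist p u = r" by (auto simp: void_balls_def)
    then show "\<exists>u\<in>cball p r. u \<in> (\<Union>(p, r)\<in>J. cball p r)"
      using vsJ by (intro bexI[of _ u]) auto
  qed
  have void: "ball (fst b) (snd b) \<inter> \<omega> = {}" "\<exists>u\<in>set vs. dist (fst b) u = snd b" if "b \<in> K" for b
    using subsetD[OF K(2) that] by (auto simp: void_balls_def)
  have fin: "finite X"
    and card: "real (card X) \<le> cells_per_vertex TYPE('a) * card (set vs) + 12 ^ DIM('a) * card {y \<in> X. cell a y \<inter> \<omega> = {}}"
    unfolding X_alt
    using cells_of_balls[where p = fst and r = snd, OF \<open>a > 0\<close> K(1) finite_set[of vs] void] by blast+
  have "cells_per_vertex TYPE('a) * card (set vs) \<le> cells_per_vertex TYPE('a) * length vs"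
    using card_length[of vs] by (intro mult_left_mono) (auto simp: cells_per_vertex_def)
  then have card': "real (card X) \<le> cells_per_vertex TYPE('a) * length vs + 12 ^ DIM('a) * card {y \<in> X. cell a y \<inter> \<omega> = {}}"
    using card by linarith
  have "0 \<in> U" using J(4) by (auto simp: U_def K_def)
  then have "0 \<in> X" unfolding X_def using cell_index_0[of a] by (metis imageI)
  obtain w where w: "w \<in> walks (2 * (card X - 1)) 0" "set w = X"
    using ex_walk[OF fin \<open>0 \<in> X\<close>] connected_cells_link[OF \<open>a > 0\<close> conn] unfolding X_def by blast
  have "Y \<subseteq> X" unfolding X_alt K_def image_UN using f(2) by blast
  then have "card Y \<le> card X" using fin by (intro card_mono)
  then have "c * a ^ DIM('a) * card Y \<le> c * a ^ DIM('a) * card X"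
    using assms(1,2) by (intro mult_left_mono) auto
  then have "t < c * a ^ DIM('a) * card X" using Y(3) by linarith
  with fin show ?thesis using card' w by (intro that) (auto simp: X_def)
qed

subsection \<open>Poisson estimates\<close>

lemma emeasure_lebesgue_borel: "A \<in> sets borel \<Longrightarrow> emeasure lebesgue A = emeasure lborel A"
  by simp

lemma lebesgue_borel: "A \<in> sets borel \<Longrightarrow> A \<in> sets lebesgue"
  by (simp add: sets_completionI_sets)

lemma poisson_count:
  assumes "poisson_random_set M \<mu> N" "A \<in> sets borel" "emeasure \<mu> A < \<infinity>"
  shows "{s \<in> space M. P (card (N s \<inter> A))} \<in> sets M"
    and "measure M {s \<in> space M. card (N s \<inter> A) = k}
         = measure \<mu> A ^ k / fact k * exp (- measure \<mu> A)"
proof -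
  have m: "(\<lambda>s. card (N s \<inter> A)) \<in> measurable M (count_space UNIV)"
    and "measure M {s \<in> space M. card (N s \<inter> A) = k}
         = measure \<mu> A ^ k / fact k * exp (- measure \<mu> A)"
    using assms unfolding poisson_random_set_def by blast+
  then show "measure M {s \<in> space M. card (N s \<inter> A) = k}
         = measure \<mu> A ^ k / fact k * exp (- measure \<mu> A)" by blast
  show "{s \<in> space M. P (card (N s \<inter> A))} \<in> sets M"
    using measurable_sets[OF m, of "Collect P"] by (simp add: vimage_def Int_def conj_commute)
qed

lemma poisson_two_points_le:
  assumes N: "poisson_random_set M \<mu> N" and A: "A \<in> sets borel" "emeasure \<mu> A < \<infinity>"
  shows "emeasure M {s \<in> space M. card (N s \<inter> A) \<ge> 2} \<le> ennreal ((measure \<mu> A)\<^sup>2)"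
proof -
  interpret prob_space M using N by (simp add: poisson_random_set_def)
  let ?l = "measure \<mu> A"
  let ?E = "\<lambda>k. {s \<in> space M. card (N s \<inter> A) = k}"
  have E: "?E k \<in> sets M" for k by (rule poisson_count(1)[OF N A])
  have "{s \<in> space M. card (N s \<inter> A) \<ge> 2} = space M - (?E 0 \<union> ?E 1)" by auto
  then have "prob {s \<in> space M. card (N s \<inter> A) \<ge> 2} = 1 - prob (?E 0 \<union> ?E 1)"
    using E by (simp add: prob_compl)
  also have "prob (?E 0 \<union> ?E 1) = prob (?E 0) + prob (?E 1)"
    using E by (intro finite_measure_Union) auto
  also have "\<dots> = (1 + ?l) * exp (- ?l)"
    by (simp add: poisson_count(2)[OF N A] algebra_simps)
  \<comment> \<open>From \<open>exp (- ?l) \<ge> 1 - ?l\<close>, since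
    \<open>(1 + ?l) * (1 - ?l)\<close> is 1 minus the square of \<open>?l\<close>.\<close>
  also have "1 - \<dots> \<le> ?l\<^sup>2"
  proof -
    have "(1 + ?l) * (1 + (- ?l)) \<le> (1 + ?l) * exp (- ?l)"
      by (intro mult_left_mono exp_ge_add_one_self) auto
    then show ?thesis by (simp add: algebra_simps power2_eq_square)
  qed
  finally show ?thesis by (simp add: emeasure_eq_measure ennreal_leI)
qed

section \<open>Almost surely distinct distances from the origin\<close>

lemma power_diff_le:
  fixes x y :: real
  assumes "0 \<le> y" "y \<le> x"
  shows "x ^ n - y ^ n \<le> n * (x - y) * x ^ (n - 1)"
proof (induction n)
  case (Suc n)
  have "x ^ Suc n - y ^ Suc n = x * (x ^ n - y ^ n) + y ^ n * (x - y)" by (simp add: algebra_simps)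
  also have "\<dots> \<le> x * (n * (x - y) * x ^ (n - 1)) + x ^ n * (x - y)"
    using assms Suc by (intro add_mono mult_left_mono mult_right_mono power_mono) auto
  also have "\<dots> = Suc n * (x - y) * x ^ (Suc n - 1)"
    by (cases n) (auto simp: algebra_simps)
  finally show ?case .
qed simp

definition shell :: "real \<Rightarrow> real \<Rightarrow> 'a::euclidean_space set" where
  "shell y x = ball 0 x - ball 0 y"

lemma emeasure_shell_le:
  assumes "0 \<le> y" "y \<le> x" "x \<le> R"
  shows "emeasure lborel (shell y x :: 'a::euclidean_space set)
    \<le> ennreal (unit_ball_vol DIM('a) * DIM('a) * R ^ (DIM('a) - 1) * (x - y))"
proof -
  have "emeasure lborel (shell y x :: 'a set)
      = emeasure lborel (ball 0 x :: 'a set) - emeasure lborel (ball 0 y :: 'a set)"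
    using assms unfolding shell_def
    by (intro emeasure_Diff) (auto simp: emeasure_ball intro: order.strict_trans2)
  also have "\<dots> = ennreal (unit_ball_vol DIM('a) * x ^ DIM('a) - unit_ball_vol DIM('a) * y ^ DIM('a))"
    using assms by (simp add: emeasure_ball ennreal_minus)
  also have "\<dots> \<le> ennreal (unit_ball_vol DIM('a) * DIM('a) * R ^ (DIM('a) - 1) * (x - y))"
  proof (rule ennreal_leI)
    have "x ^ DIM('a) - y ^ DIM('a) \<le> DIM('a) * (x - y) * x ^ (DIM('a) - 1)"
      using assms by (intro power_diff_le)
    also have "\<dots> \<le> DIM('a) * (x - y) * R ^ (DIM('a) - 1)"
      using assms by (intro mult_left_mono power_mono) auto
    finally have "unit_ball_vol DIM('a) * (x ^ DIM('a) - y ^ DIM('a))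
        \<le> unit_ball_vol DIM('a) * (DIM('a) * (x - y) * R ^ (DIM('a) - 1))"
      by (intro mult_left_mono) auto
    then show "unit_ball_vol DIM('a) * x ^ DIM('a) - unit_ball_vol DIM('a) * y ^ DIM('a)
        \<le> unit_ball_vol DIM('a) * DIM('a) * R ^ (DIM('a) - 1) * (x - y)"
      by (simp add: algebra_simps)
  qed
  finally show ?thesis .
qed

text \<open>Two nuclei of equal norm below \<open>R\<close> share one of the \<open>k + 1\<close>
  shells of equal thickness that divide the ball of radius \<open>R\<close>, for every
  \<open>k\<close>. A given shell holds two nuclei with probability of order
  \<open>1 / (k + 1)^2\<close>, so some shell does with probability of order
  \<open>1 / (k + 1)\<close>, which tends to 0.\<close>

lemma poisson_norm_inj:
  fixes \<mu> :: "'a::euclidean_space measure"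
  assumes N: "poisson_random_set M \<mu> N" and "c > 0"
    and ub: "\<forall>A\<in>sets lebesgue. emeasure \<mu> A \<le> ennreal c * emeasure lebesgue A"
  shows "AE s in M. inj_on norm (N s)"
proof -
  interpret prob_space M using N by (simp add: poisson_random_set_def)
  have lf: "AE s in M. locally_finite (N s)" using N by (simp add: poisson_random_set_def)
  define S :: "nat \<Rightarrow> nat \<Rightarrow> nat \<Rightarrow> 'a set"
    where "S R k i = shell (real R * i / Suc k) (real R * Suc i / Suc k)" for R k i
  define T where "T R k = (\<Union>i\<le>k. {s \<in> space M. card (N s \<inter> S R k i) \<ge> 2})" for R k
  \<comment> \<open>\<open>B R / Suc k\<close> bounds the measure of each shell.\<close>
  define B where "B R = c * (unit_ball_vol DIM('a) * DIM('a) * real R ^ (DIM('a) - 1) * R)" for R :: nat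
  have B0: "B R \<ge> 0" for R using \<open>c > 0\<close> by (simp add: B_def)
  have S_borel: "S R k i \<in> sets borel" for R k i by (simp add: S_def shell_def)
  have S_le: "emeasure \<mu> (S R k i) \<le> ennreal (B R / Suc k)" if "i \<le> k" for R k i
  proof -
    have "emeasure \<mu> (S R k i) \<le> ennreal c * emeasure lborel (S R k i)"
      using bspec[OF ub lebesgue_borel[OF S_borel]] emeasure_lebesgue_borel[OF S_borel] by metis
    also have "\<dots> \<le> ennreal c * ennreal (unit_ball_vol DIM('a) * DIM('a) * real R ^ (DIM('a) - 1)
        * (real R * Suc i / Suc k - real R * i / Suc k))"
      unfolding S_def using that
      by (intro mult_left_mono emeasure_shell_le)
         (auto simp: divide_right_mono mult_left_mono pos_divide_le_eq simp del: of_nat_Suc)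
    also have "\<dots> = ennreal (c * (unit_ball_vol DIM('a) * DIM('a) * real R ^ (DIM('a) - 1)
        * (real R * Suc i / Suc k - real R * i / Suc k)))"
      using \<open>c > 0\<close> by (intro ennreal_mult'[symmetric]) simp
    also have "real R * Suc i / Suc k - real R * i / Suc k = R / Suc k"
      by (simp add: diff_divide_distrib[symmetric] algebra_simps)
    finally show ?thesis by (simp add: B_def)
  qed
  have S_fin: "emeasure \<mu> (S R k i) < \<infinity>" if "i \<le> k" for R k i
    using S_le[OF that, of R] by (simp add: le_less_trans)
  have T_sets: "T R k \<in> sets M" for R k
    unfolding T_def by (intro sets.finite_UN finite_atMost poisson_count(1)[OF N S_borel S_fin]) auto
  have T_le: "emeasure M (T R k) \<le> ennreal ((B R)\<^sup>2 / Suc k)" for R k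
  proof -
    have "emeasure M (T R k) \<le> (\<Sum>i\<le>k. emeasure M {s \<in> space M. card (N s \<inter> S R k i) \<ge> 2})"
      unfolding T_def
      by (intro emeasure_subadditive_finite) (auto intro!: poisson_count(1)[OF N S_borel S_fin])
    also have "\<dots> \<le> (\<Sum>i\<le>k. ennreal ((B R / Suc k)\<^sup>2))"
    proof (rule sum_mono)
      fix i assume "i \<in> {..k}"
      then have i: "i \<le> k" by simp
      have "measure \<mu> (S R k i) \<le> B R / Suc k"
        unfolding measure_def using S_le[OF i, of R] B0[of R]
        by (intro enn2real_leI) auto
      then have "ennreal ((measure \<mu> (S R k i))\<^sup>2) \<le> ennreal ((B R / Suc k)\<^sup>2)"
        by (intro ennreal_leI power_mono) auto
      then show "emeasure M {s \<in> space M. card (N s \<inter> S R k i) \<ge> 2} \<le> ennreal ((B R / Suc k)\<^sup>2)"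
        using poisson_two_points_le[OF N S_borel S_fin[OF i]] by (rule order.trans[rotated])
    qed
    also have "\<dots> = ennreal (real (Suc k) * (B R / Suc k)\<^sup>2)"
      by (subst ennreal_mult) (simp_all add: ennreal_of_nat_eq_real_of_nat del: of_nat_Suc)
    also have "real (Suc k) * (B R / Suc k)\<^sup>2 = (B R)\<^sup>2 / Suc k"
      by (simp add: power2_eq_square del: of_nat_Suc)
    finally show ?thesis .
  qed
  have null: "(\<Inter>k. T R k) \<in> null_sets M" for R
  proof (rule null_setsI)
    show "emeasure M (\<Inter>k. T R k) = 0"
    proof (rule ccontr)
      assume ne: "emeasure M (\<Inter>k. T R k) \<noteq> 0"
      have pos: "prob (\<Inter>k. T R k) > 0"
        using ne by (simp add: emeasure_eq_measure zero_less_measure_iff)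
      obtain k :: nat where "(B R)\<^sup>2 / prob (\<Inter>k. T R k) < k" using reals_Archimedean2 by blast
      then have k: "(B R)\<^sup>2 / Suc k < prob (\<Inter>k. T R k)"
        using pos by (simp add: pos_divide_less_eq algebra_simps)
      have "emeasure M (\<Inter>k. T R k) \<le> emeasure M (T R k)"
        using T_sets by (intro emeasure_mono) auto
      then have "prob (\<Inter>k. T R k) \<le> (B R)\<^sup>2 / Suc k"
        using T_le[of R k] by (simp add: emeasure_eq_measure ennreal_le_iff order.trans)
      with k show False by simp
    qed
  qed (use T_sets in auto)
  have "AE s in M. \<forall>R. s \<notin> (\<Inter>k. T R k)"
    using AE_not_in[OF null] by (subst AE_all_countable) blast
  with lf AE_space show ?thesis
  proof eventually_elim
    case (elim s)
    show ?case
    proof (rule inj_onI, rule ccontr)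
      fix u v assume uv: "u \<in> N s" "v \<in> N s" "norm u = norm v" "u \<noteq> v"
      obtain R :: nat where R: "norm u < R" using reals_Archimedean2 by blast
      then have R0: "real R > 0" using norm_ge_zero[of u] by linarith
      have "s \<in> T R k" for k
      proof -
        \<comment> \<open>The index of the shell that contains the sphere through \<open>u\<close>
          and \<open>v\<close>.\<close>
        define i where "i = nat \<lfloor>norm u * Suc k / R\<rfloor>"
        have i1: "real i \<le> norm u * Suc k / R" "norm u * Suc k / R < real i + 1"
          unfolding i_def using R0 by auto
        have "norm u * Suc k / R < Suc k" using R R0 by (simp add: pos_divide_less_eq)
        then have "i \<le> k" using i1(1) by linarith
        have "u \<in> S R k i \<and> v \<in> S R k i"
          using i1 R0 uv(3) unfolding S_def shell_def
          by (auto simp: field_simps simp del: of_nat_Suc) (auto simp: field_simps)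
        \<comment> \<open>Finiteness matters because \<open>card\<close> is 0 on infinite
          sets.\<close>
        moreover have "finite (N s \<inter> S R k i)"
        proof (rule finite_subset)
          show "finite (N s \<inter> cball 0 (real R * Suc i / Suc k))"
            using elim(1) by (simp add: locally_finite_def)
        qed (auto simp: S_def shell_def)
        ultimately have "card {u, v} \<le> card (N s \<inter> S R k i)"
          using uv by (intro card_mono) auto
        then have "card (N s \<inter> S R k i) \<ge> 2" using uv(4) by simp
        then show ?thesis using elim(2) \<open>i \<le> k\<close> by (auto simp: T_def)
      qed
      then show False using elim(3) by blast
    qed
  qed
qed

section \<open>Void probabilities of unions of cells\<close>

text \<open>The void probability is \<open>exp (- measure \<mu> A)\<close> for the union
  \<open>A\<close> of the cells. The upper comparison makes \<open>A\<close> of finite measure, so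
  that the Poisson law applies; the lower one bounds its measure from below.\<close>

lemma void_cells_prob:
  fixes \<mu> :: "'a::euclidean_space measure" and a c :: real
  assumes N: "poisson_random_set M \<mu> N" and "a > 0" "c > 0"
    and lb: "\<forall>A\<in>sets lebesgue. ennreal (1 / c) * emeasure lebesgue A \<le> emeasure \<mu> A"
    and ub: "\<forall>A\<in>sets lebesgue. emeasure \<mu> A \<le> ennreal c * emeasure lebesgue A"
    and E: "finite E" "E \<subseteq> range (cell_index a)"
  shows "{s \<in> space M. card (N s \<inter> (\<Union>y\<in>E. cell a y)) = 0} \<in> sets M"
    and "emeasure M {s \<in> space M. card (N s \<inter> (\<Union>y\<in>E. cell a y)) = 0}
      \<le> ennreal (exp (- (card E * a ^ DIM('a) / c)))"
proof -
  interpret prob_space M using N by (simp add: poisson_random_set_def)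
  let ?A = "\<Union>y\<in>E. cell a y"
  have A: "?A \<in> sets borel" by (rule cells_borel[OF \<open>a > 0\<close> E])
  have em: "emeasure lebesgue ?A = ennreal (card E * a ^ DIM('a))"
    using emeasure_lebesgue_borel[OF A] emeasure_cells[OF \<open>a > 0\<close> E] by simp
  have "emeasure \<mu> ?A \<le> ennreal c * ennreal (card E * a ^ DIM('a))"
    using bspec[OF ub lebesgue_borel[OF A]] em by simp
  also have "\<dots> < \<infinity>" by (simp add: ennreal_mult_less_top)
  finally have fin: "emeasure \<mu> ?A < \<infinity>" .
  show "{s \<in> space M. card (N s \<inter> ?A) = 0} \<in> sets M" by (rule poisson_count(1)[OF N A fin])
  have "ennreal (1 / c * (card E * a ^ DIM('a))) = ennreal (1 / c) * ennreal (card E * a ^ DIM('a))"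
    using \<open>c > 0\<close> \<open>a > 0\<close> by (intro ennreal_mult) auto
  also have "\<dots> \<le> emeasure \<mu> ?A" using bspec[OF lb lebesgue_borel[OF A]] em by simp
  also have "\<dots> = ennreal (measure \<mu> ?A)"
    using fin by (intro emeasure_eq_ennreal_measure) auto
  finally have "card E * a ^ DIM('a) / c \<le> measure \<mu> ?A"
    by (simp add: ennreal_le_iff)
  then show "emeasure M {s \<in> space M. card (N s \<inter> ?A) = 0}
      \<le> ennreal (exp (- (card E * a ^ DIM('a) / c)))"
    using poisson_count(2)[OF N A fin, of 0] by (simp add: emeasure_eq_measure ennreal_leI)
qed

text \<open>Local finiteness yields a nucleus of least norm and injectivity of the norm its
  uniqueness, so the definite description in \<open>origin_nucleus\<close> denotes it.\<close>

lemma origin_nucleus_tile: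
  assumes lf: "locally_finite \<omega>" and inj: "inj_on norm \<omega>" and "\<omega> \<noteq> {}"
  shows "0 \<in> voronoi_tile \<omega> (origin_nucleus \<omega>)"
proof -
  obtain w where w: "w \<in> \<omega>" using assms by blast
  let ?W = "\<omega> \<inter> cball 0 (norm w)"
  have fin: "finite ?W" using lf by (simp add: locally_finite_def)
  have "?W \<noteq> {}" using w by auto
  then obtain v where v: "v \<in> ?W" "\<And>u. u \<in> ?W \<Longrightarrow> norm v \<le> norm u"
    using arg_min_if_finite[OF fin, where f = norm] by (meson not_less)
  have nearest: "norm v \<le> norm u" if "u \<in> \<omega>" for u
    using v that by (cases "norm u \<le> norm w") auto
  have "\<exists>!v. v \<in> \<omega> \<and> 0 \<in> voronoi_tile \<omega> v"
  proof (intro ex1I[of _ v] conjI)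
    fix u assume u: "u \<in> \<omega> \<and> 0 \<in> voronoi_tile \<omega> u"
    then have "norm u = norm v" using nearest v(1) by (intro antisym) (auto simp: voronoi_tile_def)
    then show "u = v" using inj u v(1) by (auto dest: inj_onD)
  qed (use nearest v(1) in \<open>auto simp: voronoi_tile_def\<close>)
  from theI'[OF this] show ?thesis by (simp add: origin_nucleus_def)
qed

subsection \<open>Union bound\<close>

text \<open>An animal of \<open>m\<close> cells is encoded by a walk visiting all of them, and
  \<open>E\<close> is a set of void cells in it. The factor 2 leaves up to half of the animal to
  cells near the path vertices.\<close>

definition void_configs :: "real \<Rightarrow> nat \<Rightarrow> ('a::euclidean_space list \<times> 'a set) set" where
  "void_configs a m = {(w, E). w \<in> walks (2 * (m - 1)) 0 \<and> E \<subseteq> set w \<and> E \<subseteq> range (cell_index a)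
     \<and> real m \<le> 2 * 12 ^ DIM('a) * card E}"

text \<open>A walk with \<open>2 * (m - 1)\<close> steps visits at most \<open>2 * m\<close> cells,
  which leaves at most \<open>4 ^ m\<close> choices of \<open>E\<close>.\<close>

lemma card_void_configs:
  assumes "m \<ge> 1"
  shows "finite (void_configs a m :: ('a::euclidean_space list \<times> 'a set) set)"
    and "card (void_configs a m :: ('a list \<times> 'a set) set) \<le> (4 * card (steps :: 'a set) ^ 2) ^ m"
proof -
  let ?K = "card (steps :: 'a set)" and ?W = "walks (2 * (m - 1)) (0 :: 'a)"
  let ?S = "Sigma ?W (\<lambda>w. Pow (set w))"
  have sub: "void_configs a m \<subseteq> ?S" by (auto simp: void_configs_def)
  have W: "finite ?W" "card ?W \<le> ?K ^ (2 * (m - 1))" using card_walks by auto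
  have fin: "finite ?S" using W by auto
  then show "finite (void_configs a m :: ('a list \<times> 'a set) set)" using sub by (rule finite_subset[rotated])
  \<comment> \<open>There is at least one step, so the exponent \<open>2 * (m - 1)\<close> may be
    raised to \<open>2 * m\<close>.\<close>
  have "(0 :: 'a) \<in> steps" by (simp add: steps_def)
  then have K: "?K \<ge> 1" using finite_steps by (simp add: Suc_le_eq card_gt_0_iff) blast
  have "card (void_configs a m :: ('a list \<times> 'a set) set) \<le> card ?S" by (rule card_mono[OF fin sub])
  also have "\<dots> = (\<Sum>w\<in>?W. card (Pow (set w)))" using W by (intro card_SigmaI) auto
  also have "\<dots> \<le> (\<Sum>w\<in>?W. 2 ^ (2 * m))"
  proof (rule sum_mono)
    fix w assume "w \<in> ?W"
    then have "card (set w) \<le> 2 * m" using card_length[of w] \<open>m \<ge> 1\<close> by (auto simp: walks_def)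
    then show "card (Pow (set w)) \<le> 2 ^ (2 * m)" by (simp add: card_Pow power_increasing)
  qed
  also have "\<dots> = card ?W * 2 ^ (2 * m)" by simp
  also have "\<dots> \<le> ?K ^ (2 * m) * 2 ^ (2 * m)"
    using order.trans[OF W(2) power_increasing[OF _ K, of "2 * (m - 1)" "2 * m"]]
    by (intro mult_right_mono) auto
  also have "\<dots> = (4 * ?K ^ 2) ^ m"
    by (simp add: power_mult power_mult_distrib)
  finally show "card (void_configs a m :: ('a list \<times> 'a set) set) \<le> (4 * ?K ^ 2) ^ m" .
qed

text \<open>The side length \<open>a\<close> of the cells has to beat the number of walks.\<close>

lemma void_configs_prob:
  fixes \<mu> :: "'a::euclidean_space measure" and a c :: real
  assumes N: "poisson_random_set M \<mu> N" and "a > 0" "c > 0"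
    and lb: "\<forall>A\<in>sets lebesgue. ennreal (1 / c) * emeasure lebesgue A \<le> emeasure \<mu> A"
    and ub: "\<forall>A\<in>sets lebesgue. emeasure \<mu> A \<le> ennreal c * emeasure lebesgue A"
    and large: "4 * real (card (steps :: 'a set)) ^ 2 * exp (- (a ^ DIM('a) / (2 * 12 ^ DIM('a) * c))) \<le> 1 / 4"
    and "m \<ge> 1"
  defines "B \<equiv> \<Union>(w, E)\<in>void_configs a m. {s \<in> space M. card (N s \<inter> (\<Union>y\<in>E. cell a y)) = 0}"
  shows "B \<in> sets M" and "emeasure M B \<le> ennreal ((1 / 4) ^ m)"
proof -
  let ?C = "void_configs a m :: ('a list \<times> 'a set) set"
  let ?V = "\<lambda>E. {s \<in> space M. card (N s \<inter> (\<Union>y\<in>E. cell a y)) = 0}"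
  let ?q = "exp (- (a ^ DIM('a) / (2 * 12 ^ DIM('a) * c)))"
  have fin: "finite ?C" by (rule card_void_configs(1)[OF \<open>m \<ge> 1\<close>])
  have V: "?V (snd x) \<in> sets M" "emeasure M (?V (snd x)) \<le> ennreal (?q ^ m)" if "x \<in> ?C" for x
  proof -
    obtain w E where x: "x = (w, E)" "E \<subseteq> set w" "E \<subseteq> range (cell_index a)"
        "real m \<le> 2 * 12 ^ DIM('a) * card E"
      using \<open>x \<in> ?C\<close> by (auto simp: void_configs_def)
    have E: "finite E" using x(2) by (rule finite_subset) simp
    note prob = void_cells_prob[OF N \<open>a > 0\<close> \<open>c > 0\<close> lb ub E x(3)]
    show "?V (snd x) \<in> sets M" using prob(1) x(1) by simp
    have "real m * (a ^ DIM('a) / (2 * 12 ^ DIM('a) * c))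
        \<le> (2 * 12 ^ DIM('a) * card E) * (a ^ DIM('a) / (2 * 12 ^ DIM('a) * c))"
      using x(4) \<open>a > 0\<close> \<open>c > 0\<close> by (intro mult_right_mono) auto
    also have "\<dots> = card E * a ^ DIM('a) / c" using \<open>c > 0\<close> by (simp add: field_simps)
    finally have "exp (- (card E * a ^ DIM('a) / c)) \<le> ?q ^ m"
      by (simp add: exp_of_nat_mult[symmetric])
    then show "emeasure M (?V (snd x)) \<le> ennreal (?q ^ m)"
      using prob(2) x(1) by (simp add: ennreal_leI order.trans)
  qed
  have B: "B = (\<Union>x\<in>?C. ?V (snd x))" by (simp add: B_def case_prod_beta')
  show "B \<in> sets M" unfolding B using fin V(1) by (intro sets.finite_UN) auto
  have "emeasure M B \<le> (\<Sum>x\<in>?C. emeasure M (?V (snd x)))"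
    unfolding B using fin V(1) by (intro emeasure_subadditive_finite) auto
  also have "\<dots> \<le> (\<Sum>x\<in>?C. ennreal (?q ^ m))" by (intro sum_mono V(2))
  also have "\<dots> = ennreal (real (card ?C) * ?q ^ m)"
    by (simp add: ennreal_mult' ennreal_of_nat_eq_real_of_nat)
  also have "\<dots> \<le> ennreal ((1 / 4) ^ m)"
  proof (rule ennreal_leI)
    have "real (card ?C) \<le> real ((4 * card (steps :: 'a set) ^ 2) ^ m)"
      using card_void_configs(2)[OF \<open>m \<ge> 1\<close>, of a] of_nat_le_iff by blast
    then have "real (card ?C) * ?q ^ m \<le> (4 * real (card (steps :: 'a set)) ^ 2) ^ m * ?q ^ m"
      by (intro mult_right_mono) auto
    also have "\<dots> = (4 * real (card (steps :: 'a set)) ^ 2 * ?q) ^ m" by (simp only: power_mult_distrib)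
    also have "\<dots> \<le> (1 / 4) ^ m" using large by (intro power_mono) auto
    finally show "real (card ?C) * ?q ^ m \<le> (1 / 4) ^ m" .
  qed
  finally show "emeasure M B \<le> ennreal ((1 / 4) ^ m)" .
qed

text \<open>The geometric series gives \<open>(1 / 4) ^ m0 * (4 / 3)\<close>; as
  \<open>m0 \<ge> 1\<close>, half of the exponential decay absorbs the factor 4/3.\<close>

lemma geometric_tail_le:
  fixes B :: "nat \<Rightarrow> 's set"
  assumes "\<And>m. m \<ge> m0 \<Longrightarrow> B m \<in> sets M" "\<And>m. m \<ge> m0 \<Longrightarrow> emeasure M (B m) \<le> ennreal ((1 / 4) ^ m)"
    and "m0 \<ge> 1"
  shows "emeasure M (\<Union>m\<in>{m0..}. B m) \<le> ennreal ((1 / 2) ^ m0)"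
proof -
  have "{m0..} = range (\<lambda>k. m0 + k)" by (auto simp: le_iff_add image_iff)
  then have "(\<Union>m\<in>{m0..}. B m) = (\<Union>k. B (m0 + k))" by simp
  moreover have "range (\<lambda>k. B (m0 + k)) \<subseteq> sets M" using assms(1) by force
  ultimately have "emeasure M (\<Union>m\<in>{m0..}. B m) \<le> (\<Sum>k. emeasure M (B (m0 + k)))"
    using emeasure_subadditive_countably by metis
  also have "\<dots> \<le> (\<Sum>k. ennreal ((1 / 4) ^ m0 * (1 / 4) ^ k))"
    unfolding power_add[symmetric] using assms(2) by (intro suminf_le) auto
  also have "\<dots> = ennreal ((1 / 4) ^ m0 * (4 / 3))"
  proof (rule suminf_ennreal_eq)
    show "(\<lambda>k. (1 / 4 :: real) ^ m0 * (1 / 4) ^ k) sums ((1 / 4) ^ m0 * (4 / 3))"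
      using geometric_sums[of "1 / 4 :: real"] by (intro sums_mult) simp
  qed simp
  also have "\<dots> \<le> ennreal ((1 / 2) ^ m0)"
  proof (rule ennreal_leI)
    have "(1 / 2 :: real) ^ m0 \<le> 1 / 2" using power_decreasing[OF \<open>m0 \<ge> 1\<close>, of "1 / 2 :: real"] by simp
    then have "(1 / 2 :: real) ^ m0 * ((1 / 2) ^ m0 * (4 / 3)) \<le> (1 / 2) ^ m0 * 1"
      by (intro mult_left_mono) auto
    then show "(1 / 4 :: real) ^ m0 * (4 / 3) \<le> (1 / 2) ^ m0"
      by (simp add: power_mult_distrib[symmetric] mult.assoc[symmetric])
  qed
  finally show ?thesis .
qed

section \<open>Choice of the constants and conclusion\<close>

theorem proposition2p5:
  fixes M :: "'s measure"
    and \<mu> :: "'a::euclidean_space measure"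
    and N :: "'s \<Rightarrow> 'a set"
  assumes "DIM('a) \<ge> 2"
    and "comparable_to_lebesgue \<mu>"
    and "poisson_random_set M \<mu> N"
  shows "\<exists>z1 C1 :: real. z1 > 0 \<and> C1 > 0 \<and>
           (\<forall>z\<ge>z1. \<forall>n::nat.
              outer_measure_of M {s \<in> space M. max_Gam \<mu> (N s) n > ennreal (real n * z)}
                \<le> ennreal (exp (- C1 * real n * z)))"
proof -
  interpret prob_space M using assms(3) by (simp add: poisson_random_set_def)
  obtain c :: real where sets: "sets \<mu> = sets lebesgue" and c: "c > 0"
    and lb: "\<forall>A\<in>sets lebesgue. ennreal (1 / c) * emeasure lebesgue A \<le> emeasure \<mu> A"
    and ub: "\<forall>A\<in>sets lebesgue. emeasure \<mu> A \<le> ennreal c * emeasure lebesgue A"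
    using assms(2) unfolding comparable_to_lebesgue_def by blast
  define D :: real where "D = 12 ^ DIM('a)"
  define K :: real where "K = real (card (steps :: 'a set)) ^ 2"
  define C0 where "C0 = cells_per_vertex TYPE('a)"
  \<comment> \<open>Chosen so that \<open>4 * K\<close> times the void factor per cell of the animal
    is at most 1/4; the maximum with 1 ensures \<open>a \<le> a ^ DIM('a)\<close>.\<close>
  define a where "a = max 1 (2 * D * c * ln (16 * K))"
  \<comment> \<open>An upper bound for the measure of one cell.\<close>
  define b where "b = c * a ^ DIM('a)"
  have D: "D > 0" by (simp add: D_def)
  have "(0 :: 'a) \<in> steps" by (simp add: steps_def)
  then have K: "K > 0" using finite_steps by (auto simp: K_def card_gt_0_iff)
  have C0: "C0 \<ge> 0" by (simp add: C0_def cells_per_vertex_def)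
  have a: "a > 0" "a \<ge> 1" by (auto simp: a_def)
  have b: "b > 0" using a c by (simp add: b_def)
  have "2 * D * c * ln (16 * K) \<le> a" by (simp add: a_def)
  also have "a \<le> a ^ DIM('a)" using a(2) by (intro self_le_power) auto
  finally have "ln (16 * K) \<le> a ^ DIM('a) / (2 * D * c)"
    using D c by (simp add: pos_le_divide_eq mult.commute)
  then have "exp (- (a ^ DIM('a) / (2 * D * c))) \<le> exp (- ln (16 * K))" by simp
  also have "\<dots> = 1 / (16 * K)" using K by (simp add: exp_minus inverse_eq_divide)
  finally have "4 * K * exp (- (a ^ DIM('a) / (2 * D * c))) \<le> 4 * K * (1 / (16 * K))"
    using K by (intro mult_left_mono) auto
  then have large: "4 * K * exp (- (a ^ DIM('a) / (2 * D * c))) \<le> 1 / 4" using K by simp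
  define B where "B m = (\<Union>(w, E)\<in>void_configs a m. {s \<in> space M. card (N s \<inter> (\<Union>y\<in>E. cell a y)) = 0})"
    for m
  have B: "B m \<in> sets M" "emeasure M (B m) \<le> ennreal ((1 / 4) ^ m)" if "m \<ge> 1" for m
    using void_configs_prob[OF assms(3) a(1) c lb ub large[unfolded K_def D_def] that]
    unfolding B_def by blast+
  have "AE s in M. locally_finite (N s)" using assms(3) by (simp add: poisson_random_set_def)
  then have "AE s in M. locally_finite (N s) \<and> inj_on norm (N s)"
    using poisson_norm_inj[OF assms(3) c ub] by eventually_elim blast
  then obtain Z where Z: "Z \<in> null_sets M"
      "\<And>s. s \<in> space M \<Longrightarrow> s \<notin> Z \<Longrightarrow> locally_finite (N s) \<and> inj_on norm (N s)"
    unfolding eventually_ae_filter by blast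
  \<comment> \<open>The first summand makes the contribution \<open>C0 * n\<close> of the path
    vertices at most half of the animal; the second keeps \<open>z1\<close> positive even if the
    first vanishes.\<close>
  define z1 where "z1 = 2 * C0 * b + b"
  have "outer_measure_of M {s \<in> space M. max_Gam \<mu> (N s) n > ennreal (real n * z)}
      \<le> ennreal (exp (- (ln 2 / b) * real n * z))" (is "outer_measure_of M ?X \<le> _")
    if z: "z \<ge> z1" for z n
  proof (cases "n = 0")
    case True
    \<comment> \<open>Paths are nonempty, so for \<open>n = 0\<close> the supremum is 0 and does not
      exceed the threshold 0.\<close>
    have "SA \<omega> 0 = {}" for \<omega> :: "'a set" by (auto simp: SA_def)
    then have "?X = {}" using True by (simp add: max_Gam_def)
    then show ?thesis by (simp only: outer_measure_of_eq[OF sets.empty_sets] emeasure_empty) simp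
  next
    case False
    have "2 * C0 * b \<ge> 0" using b C0 by simp
    then have zb: "z \<ge> 2 * C0 * b" "z > 0" using z b unfolding z1_def by linarith+
    \<comment> \<open>The animal has more than \<open>n * z / b\<close> cells, hence at least
      \<open>m0\<close>.\<close>
    define m0 where "m0 = nat \<lceil>n * z / b\<rceil>"
    have nz: "n * z / b > 0" using False zb b by simp
    have m0: "m0 \<ge> 1" "n * z / b \<le> m0" using nz unfolding m0_def by linarith+
    have "?X \<subseteq> (\<Union>m\<in>{m0..}. B m) \<union> Z"
    proof
      fix s assume "s \<in> ?X"
      then have s: "s \<in> space M" "max_Gam \<mu> (N s) n > ennreal (real n * z)" by auto
      obtain vs where vs: "length vs = n" "vs \<noteq> []" "hd vs = origin_nucleus (N s)"
          "subgraph (path_graph vs) (delaunay (N s))"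
          "emeasure \<mu> (Gam (N s) (path_graph vs)) > ennreal (real n * z)"
        using s(2) unfolding max_Gam_def less_SUP_iff SA_def by blast
      show "s \<in> (\<Union>m\<in>{m0..}. B m) \<union> Z"
      proof (cases "s \<in> Z")
        case sZ: False
        have "N s \<noteq> {}"
          using vs(2,4) by (auto simp: subgraph_def path_graph_def delaunay_def)
        then have origin: "0 \<in> voronoi_tile (N s) (hd vs)"
          using origin_nucleus_tile Z(2)[OF s(1) sZ] vs(3) by metis
        have t: "real n * z \<ge> 0" using zb by simp
        obtain X w where X: "finite X" "X \<subseteq> range (cell_index a)" "real n * z < c * a ^ DIM('a) * card X"
            "w \<in> walks (2 * (card X - 1)) 0" "set w = X"
            "real (card X) \<le> cells_per_vertex TYPE('a) * length vs
              + 12 ^ DIM('a) * card {y \<in> X. cell a y \<inter> N s = {}}"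
          by (rule path_animal[OF a(1) c t sets ub vs(4,2) origin vs(5)])
        define E where "E = {y \<in> X. cell a y \<inter> N s = {}}"
        have nX: "n * z / b < card X" using X(3) b by (simp add: b_def pos_divide_less_eq mult.commute)
        \<comment> \<open>With \<open>nX\<close>, this gives \<open>C0 * n \<le> card X / 2\<close>,
          so the void cells must account for the other half of \<open>X\<close>.\<close>
        have "2 * C0 * n \<le> n * z / b"
          using mult_left_mono[OF zb(1), of "real n"] b by (simp add: pos_le_divide_eq mult_ac)
        then have "real (card X) \<le> 2 * 12 ^ DIM('a) * card E"
          using X(6) nX unfolding E_def[symmetric] C0_def[symmetric] vs(1) by linarith
        then have wE: "(w, E) \<in> void_configs a (card X)"
          using X by (auto simp: void_configs_def E_def)
        have "N s \<inter> (\<Union>y\<in>E. cell a y) = {}" by (auto simp: E_def)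
        then have "card (N s \<inter> (\<Union>y\<in>E. cell a y)) = 0" by (simp only: card.empty)
        then have "s \<in> B (card X)"
          unfolding B_def using s(1) by (intro UN_I[OF wE]) (simp only: prod.case mem_Collect_eq simp_thms)
        moreover have "m0 \<le> card X" using nX unfolding m0_def by linarith
        ultimately show ?thesis by auto
      qed simp
    qed
    moreover have BS: "(\<Union>m\<in>{m0..}. B m) \<in> sets M"
      using B(1) m0(1) by (intro sets.countable_UN') auto
    ultimately have "outer_measure_of M ?X \<le> emeasure M ((\<Union>m\<in>{m0..}. B m) \<union> Z)"
      using outer_measure_of_mono[of ?X "(\<Union>m\<in>{m0..}. B m) \<union> Z" M] null_setsD2[OF Z(1)] by simp
    also have "\<dots> = emeasure M (\<Union>m\<in>{m0..}. B m)"
      using BS Z(1) by (rule emeasure_Un_null_set)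
    also have "\<dots> \<le> ennreal ((1 / 2) ^ m0)"
      using B m0(1) by (intro geometric_tail_le[where B = B and M = M and ?m0.0 = m0]) auto
    also have "\<dots> \<le> ennreal (exp (- (ln 2 / b) * real n * z))"
    proof (rule ennreal_leI)
      \<comment> \<open>Rewriting the power of 1/2 in base \<open>e\<close> and using
        \<open>m0 \<ge> n * z / b\<close> gives the rate \<open>ln 2 / b\<close>.\<close>
      have "(1 / 2 :: real) ^ m0 = exp (- ln 2 * real m0)"
        by (simp add: exp_minus exp_of_nat2_mult power_one_over inverse_eq_divide)
      also have "\<dots> \<le> exp (- ln 2 * (n * z / b))"
        unfolding exp_le_cancel_iff using m0(2) by (intro mult_left_mono_neg) auto
      finally show "(1 / 2) ^ m0 \<le> exp (- (ln 2 / b) * real n * z)" by (simp add: mult_ac)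
    qed
    finally show ?thesis .
  qed
  moreover have "z1 > 0" using b C0 by (simp add: z1_def add_nonneg_pos)
  moreover have "ln 2 / b > 0" using b by simp
  ultimately show ?thesis by blast
qed

end
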